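(* Let $k\ge 2$ and $N=G_k=2^{2k+1}+2^{k+1}+1$. Let $m$ be an integer coprime to $N$ which is a fourth power modulo $N$, let $E:y^2=x^3-mx$ with arithmetic modulo $N$, and let $\eta=1+i$ be the endomorphism described in the context. Let $P=(x,y)$ be a point on $E$ with $x$ a quadratic non-residue modulo $N$. Then $N$ is prime if and only if $\eta^{2k-1}P\in E[2]\setminus\{\infty\}$, i.e. $\eta^{2k-1}P\in\{(0,0),(\sqrt m,0),(-\sqrt m,0)\}$.
   Context: Let $i$ be a square root of $-1$ modulo $N$ and $\sqrt m$ a square root of $m$ modulo $N$. The map $[i](x,y)=(-x,iy)$ is an automorphism of $E$, and $\eta=[1+i]$ is the endomorphism $\eta(x,y)=(x,y)+[i](x,y)$ (elliptic curve addition, identity $\infty$ the point at infinity); for $x\neq0$ the $x$-coordinate of $\eta(x,y)$ is $\frac{x^2-m}{2ix}$. $\eta^j$ is the $j$-fold iterate. $E[2]$ denotes the $2$-torsion $\{\infty,(0,0),(\pm\sqrt m,0)\}$. When $N$ is composite, the condition is understood as the result of carrying out these computations modulo $N$ (equivalently, holding on the reduction of $E$ modulo prime divisors of $N$). *)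

theory Defs
  imports "HOL-Number_Theory.Number_Theory"
begin

text \<open>
  Arithmetic modulo \<open>n\<close> on the curve \<open>y\<^sup>2 = x\<^sup>3 - m x\<close>. An affine point is represented by its
  coordinates reduced to \<open>{0..<n}\<close>, so that equality of points is equality of values.
\<close>

datatype ec_point = Infinity | Affine int int

definition ec_affine :: "int \<Rightarrow> int \<Rightarrow> int \<Rightarrow> ec_point" where
  "ec_affine n x y = Affine (x mod n) (y mod n)"

text \<open>
  Chord-and-tangent addition. It is partial: the result is \<open>None\<close> if the denominator of the slope
  is not invertible modulo \<open>n\<close>. For an odd prime \<open>n\<close> not dividing \<open>m\<close> and points on the curve
  this never happens, and the operation is the group law of the elliptic curve over the field with
  \<open>n\<close> elements.
\<close>

fun ec_add :: "int \<Rightarrow> int \<Rightarrow> ec_point \<Rightarrow> ec_point \<Rightarrow> ec_point option" where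
  "ec_add n m Infinity Q = Some Q"
| "ec_add n m P Infinity = Some P"
| "ec_add n m (Affine x1 y1) (Affine x2 y2) =
     (if [x1 = x2] (mod n) \<and> [y1 = - y2] (mod n) then Some Infinity
      else
        let (u, v) = (if [x1 = x2] (mod n) \<and> [y1 = y2] (mod n)
                      then (3 * x1\<^sup>2 - m, 2 * y1)
                      else (y2 - y1, x2 - x1))
        in if coprime v n
           then let l = u * modular_inverse n v;
                    x3 = l\<^sup>2 - x1 - x2
                in Some (ec_affine n x3 (l * (x1 - x3) - y1))
           else None)"

text \<open>The parameter \<open>i\<close> is a square root of \<open>-1\<close> modulo \<open>n\<close>.\<close>

fun ec_i :: "int \<Rightarrow> int \<Rightarrow> ec_point \<Rightarrow> ec_point" where
  "ec_i n i Infinity = Infinity"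
| "ec_i n i (Affine x y) = ec_affine n (- x) (i * y)"

definition ec_eta :: "int \<Rightarrow> int \<Rightarrow> int \<Rightarrow> ec_point \<Rightarrow> ec_point option" where
  "ec_eta n m i P = ec_add n m P (ec_i n i P)"

primrec ec_eta_iter :: "int \<Rightarrow> int \<Rightarrow> int \<Rightarrow> nat \<Rightarrow> ec_point \<Rightarrow> ec_point option" where
  "ec_eta_iter n m i 0 P = Some P"
| "ec_eta_iter n m i (Suc j) P = Option.bind (ec_eta_iter n m i j P) (ec_eta n m i)"

text \<open>
  The parameter \<open>s\<close> is a square root of \<open>m\<close> modulo \<open>n\<close>. For composite \<open>n\<close> there are in general
  more points with \<open>Q + Q = \<infinity>\<close>; only the four given by the chosen root are meant.
\<close>

definition ec_two_torsion :: "int \<Rightarrow> int \<Rightarrow> ec_point set" where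
  "ec_two_torsion n s =
     {Infinity, ec_affine n 0 0, ec_affine n s 0, ec_affine n (- s) 0}"

text \<open>
  The computation of \<open>\<eta>\<^sup>j(x, y)\<close> modulo \<open>n\<close> goes through and gives a point of \<open>E[2]\<close> other than
  \<open>\<infinity>\<close>.
\<close>

definition ec_eta_condition ::
    "int \<Rightarrow> int \<Rightarrow> int \<Rightarrow> int \<Rightarrow> nat \<Rightarrow> int \<Rightarrow> int \<Rightarrow> bool" where
  "ec_eta_condition n m i s j x y \<longleftrightarrow>
     (\<exists>Q \<in> ec_two_torsion n s - {Infinity}. ec_eta_iter n m i j (ec_affine n x y) = Some Q)"

end

theory Submission
  imports Defs
begin

text \<open>
  Let \<open>p\<close> be a prime divisor of \<open>N\<close> and \<open>E\<close> the group of points modulo \<open>p\<close>. The kernel of \<open>\<eta>\<close> on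
  \<open>E\<close> is \<open>{\<infinity>, (0, 0)}\<close>, so if \<open>(0, 0)\<close> lies in \<open>\<eta>\<^sup>j E\<close>, then \<open>2\<^sup>j\<^sup>+\<^sup>1\<close> divides \<open>|E|\<close>. The condition on
  \<open>P\<close> therefore gives \<open>2\<^sup>2\<^sup>k \<le> |E| \<le> 2 p + 1\<close>, which excludes \<open>p\<^sup>2 \<le> N\<close>.

  If \<open>N = p\<close> is prime, then \<open>|E| = p + 1 + \<phi> m\<close> for the Jacobsthal sum \<open>\<phi>\<close>, and
  \<open>(\<phi> m)\<^sup>2 + (\<phi> (g m))\<^sup>2 = 4 p\<close> for a non-residue \<open>g\<close>. As \<open>p = (2\<^sup>k + 1)\<^sup>2 + (2\<^sup>k)\<^sup>2\<close> is the only
  representation of \<open>p\<close> as a sum of two squares and \<open>8\<close> divides \<open>|E|\<close>, it follows that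
  \<open>|E| = 2\<^sup>2\<^sup>k\<^sup>+\<^sup>1\<close>. Then \<open>\<eta>\<close> is nilpotent and \<open>\<eta> E\<close> is the kernel of \<open>\<eta>\<^sup>2\<^sup>k\<close>; since \<open>x\<close>-coordinates of
  points in \<open>\<eta> E\<close> are squares, \<open>\<eta>\<^sup>2\<^sup>k P = (0, 0)\<close>.

  None of this needs the associativity of the addition: it is enough that \<open>\<eta>\<close> maps collinear
  points to collinear points.
\<close>

section \<open>Endomorphisms of symmetric quasigroups\<close>

text \<open>Apart from its only fixed point \<open>e\<close>, the involution splits \<open>S\<close>
  into pairs \<open>{a, f a}\<close>.\<close>

lemma odd_card_of_involution:
  assumes "finite S" "\<And>a. a \<in> S \<Longrightarrow> f a \<in> S" "\<And>a. a \<in> S \<Longrightarrow> f (f a) = a"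
    and "e \<in> S" "\<And>a. a \<in> S \<Longrightarrow> f a = a \<longleftrightarrow> a = e"
  shows "odd (card S)"
proof -
  have "even (card T)" if "T \<subseteq> S - {e}" "\<And>a. a \<in> T \<Longrightarrow> f a \<in> T" for T
    using finite_subset[OF that(1) finite_Diff[OF assms(1)]] that
  proof (induction T rule: finite_psubset_induct)
    case (psubset T)
    show ?case
    proof (cases "T = {}")
      case False
      then obtain a where a: "a \<in> T" by blast
      have aS: "a \<in> S" "a \<noteq> e" and fa: "f a \<in> T" "f a \<noteq> a" "f (f a) = a"
        using a psubset.prems assms(3,5) by auto
      have "even (card (T - {a, f a}))"
      proof (rule psubset.IH)
        show "T - {a, f a} \<subset> T" using a by blast
        show "T - {a, f a} \<subseteq> S - {e}" using psubset.prems by blast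
        show "f b \<in> T - {a, f a}" if "b \<in> T - {a, f a}" for b
          using that psubset.prems assms(3) fa
          by (metis Diff_iff empty_iff insert_iff subsetD)
      qed
      moreover have "card (T - {a, f a}) + 2 = card T"
        using a fa psubset.hyps card_Diff_subset[of "{a, f a}" T] card_mono[of T "{a, f a}"]
        by auto
      ultimately show ?thesis by presburger
    qed simp
  qed
  from this[of "S - {e}"] have "even (card (S - {e}))"
    using assms(2-5) by (metis Diff_iff empty_iff insert_iff order_refl)
  moreover have "card S = Suc (card (S - {e}))"
    using assms(1,4) by (rule card_Suc_Diff1[symmetric])
  ultimately show ?thesis by simp
qed

text \<open>
  The operation \<open>t\<close> models \<open>A, B \<mapsto> - (A + B)\<close>, the third intersection point of the line through
  \<open>A\<close> and \<open>B\<close>.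
\<close>

locale symmetric_quasigroup =
  fixes E :: "'a set" and e :: 'a and t :: "'a \<Rightarrow> 'a \<Rightarrow> 'a"
  assumes finite_E: "finite E" and e_in: "e \<in> E" and t_e_e: "t e e = e"
    and t_in: "\<And>A B. A \<in> E \<Longrightarrow> B \<in> E \<Longrightarrow> t A B \<in> E"
    and t_commute: "\<And>A B. A \<in> E \<Longrightarrow> B \<in> E \<Longrightarrow> t A B = t B A"
    and t_cancel: "\<And>A B. A \<in> E \<Longrightarrow> B \<in> E \<Longrightarrow> t A (t A B) = B"
begin

lemma t_cancel': "A \<in> E \<Longrightarrow> B \<in> E \<Longrightarrow> t (t A B) B = A"
  using t_cancel[of B A] t_commute[of A B] t_commute[of "t A B" B] t_in by simp

text \<open>The usual count for a homomorphism: every fibre is in bijection with the kernel. A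
  self-inverse map built from \<open>t\<close> takes the place of translation.\<close>

lemma card_eq_card_image_times_card_kernel:
  assumes F: "F \<subseteq> E" "e \<in> F" "\<And>A B. A \<in> F \<Longrightarrow> B \<in> F \<Longrightarrow> t A B \<in> F"
    and h: "h ` F \<subseteq> E" "h e = e" "\<And>A B. A \<in> F \<Longrightarrow> B \<in> F \<Longrightarrow> h (t A B) = t (h A) (h B)"
  shows "card F = card (h ` F) * card {C \<in> F. h C = e}"
proof -
  have fin: "finite F" using F(1) finite_E finite_subset by blast
  have fibre: "card {B \<in> F. h B = Y} = card {C \<in> F. h C = e}" if Y: "Y \<in> h ` F" for Y
  proof -
    obtain A where A: "A \<in> F" "Y = h A" using Y by blast
    \<comment> \<open>\<open>A'\<close> stands for \<open>- A\<close>, so \<open>t A'\<close> is the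
      map \<open>B \<mapsto> A - B\<close>. It exchanges the fibre of \<open>A\<close> and the
      kernel and is its own inverse by \<open>t_cancel\<close>.\<close>
    define A' where "A' = t e A"
    have A': "A' \<in> F" "h A' = t e Y" using A F h by (auto simp: A'_def)
    have "Y \<in> E" using Y h by blast
    have sub: "\<And>C. C \<in> F \<Longrightarrow> C \<in> E" using F by blast
    have "h (t A' B) = e" if "B \<in> F" "h B = Y" for B
      using that h(3)[OF A'(1) that(1)] A'(2) t_cancel'[OF e_in \<open>Y \<in> E\<close>] by simp
    moreover have "h (t A' C) = Y" if "C \<in> F" "h C = e" for C
      using that h(3)[OF A'(1) that(1)] A'(2) t_commute[OF t_in[OF e_in \<open>Y \<in> E\<close>] e_in]
        t_cancel[OF e_in \<open>Y \<in> E\<close>] by simp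
    ultimately have bb: "bij_betw (t A') {B \<in> F. h B = Y} {C \<in> F. h C = e}"
      by (intro bij_betw_byWitness[where f' = "t A'"]) (use A' F sub t_cancel in auto)
    thus ?thesis by (rule bij_betw_same_card)
  qed
  have "card F = (\<Sum>Y \<in> h ` F. card {B \<in> F. h B = Y})"
    using sum.image_gen[OF fin, of "\<lambda>_. 1::nat" h] by simp
  also have "\<dots> = card (h ` F) * card {C \<in> F. h C = e}"
    using fibre by simp
  finally show ?thesis .
qed

end

section \<open>The chain of images of an endomorphism with a kernel of order two\<close>

locale symmetric_quasigroup_endo = symmetric_quasigroup +
  fixes \<eta> :: "'a \<Rightarrow> 'a" and z :: 'a
  assumes eta_in: "\<And>A. A \<in> E \<Longrightarrow> \<eta> A \<in> E"
    and eta_t: "\<And>A B. A \<in> E \<Longrightarrow> B \<in> E \<Longrightarrow> \<eta> (t A B) = t (\<eta> A) (\<eta> B)"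
    and z_in: "z \<in> E" and z_neq: "z \<noteq> e"
    and eta_eq_e_iff: "\<And>A. A \<in> E \<Longrightarrow> \<eta> A = e \<longleftrightarrow> A = e \<or> A = z"
begin

definition F :: "nat \<Rightarrow> 'a set" where "F j = (\<eta> ^^ j) ` E"

lemma eta_e: "\<eta> e = e" using eta_eq_e_iff e_in by blast

lemma iter_e: "(\<eta> ^^ j) e = e" by (induction j) (auto simp: eta_e)

lemma iter_in: "A \<in> E \<Longrightarrow> (\<eta> ^^ j) A \<in> E" by (induction j) (auto simp: eta_in)

lemma iter_t: "A \<in> E \<Longrightarrow> B \<in> E \<Longrightarrow> (\<eta> ^^ j) (t A B) = t ((\<eta> ^^ j) A) ((\<eta> ^^ j) B)"
  by (induction j) (auto simp: eta_t iter_in)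

lemma F_subset: "F j \<subseteq> E" by (auto simp: F_def iter_in)

lemma finite_F: "finite (F j)" using F_subset finite_E finite_subset by blast

lemma e_in_F: "e \<in> F j" unfolding F_def using iter_e e_in by (metis imageI)

lemma F_t: "A \<in> F j \<Longrightarrow> B \<in> F j \<Longrightarrow> t A B \<in> F j"
  unfolding F_def by (auto simp: t_in simp flip: iter_t)

lemma F_Suc: "F (Suc j) = \<eta> ` F j" by (auto simp: F_def image_image)

lemma F_Suc_subset: "F (Suc j) \<subseteq> F j"
  using eta_in by (auto simp: F_def funpow_Suc_right simp del: funpow.simps)

lemma F_antimono: "j \<le> l \<Longrightarrow> F l \<subseteq> F j"
  using F_Suc_subset by (rule lift_Suc_antimono_le)

text \<open>The kernel of \<open>\<eta>\<close> on \<open>F j\<close> is \<open>{e, z}\<close> or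
  \<open>{e}\<close>, so each step of the chain halves the order or keeps it.\<close>

lemma card_F_Suc: "card (F j) = card (F (Suc j)) * (if z \<in> F j then 2 else 1)"
proof -
  have "card (F j) = card (\<eta> ` F j) * card {C \<in> F j. \<eta> C = e}"
    by (rule card_eq_card_image_times_card_kernel)
       (insert F_subset e_in_F F_t eta_in eta_e eta_t, auto simp: subset_iff)
  moreover have "{C \<in> F j. \<eta> C = e} = (if z \<in> F j then {e, z} else {e})"
    using F_subset e_in_F eta_eq_e_iff by (auto simp: subset_iff)
  ultimately show ?thesis using z_neq by (auto simp: F_Suc)
qed

lemma card_E_iter_kernel: "card E = card (F j) * card {C \<in> E. (\<eta> ^^ j) C = e}"
  unfolding F_def
  by (rule card_eq_card_image_times_card_kernel) (auto simp: iter_in iter_e iter_t e_in t_in)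

lemma card_E_of_z_in_F:
  assumes "\<And>l. l < j \<Longrightarrow> z \<in> F l"
  shows "card E = 2 ^ j * card (F j)"
  using assms
proof (induction j)
  case 0
  thus ?case by (simp add: F_def)
next
  case (Suc j)
  thus ?case using card_F_Suc[of j] by simp
qed

text \<open>The chain \<open>F\<close> decreases, so \<open>z\<close> lies in
  \<open>F 0, ..., F j\<close>, and the order is halved \<open>j + 1\<close> times.\<close>

lemma two_power_dvd_card_E:
  assumes "A \<in> E" "(\<eta> ^^ j) A = z"
  shows "2 ^ Suc j dvd card E"
proof -
  have "z \<in> F j" using assms by (auto simp: F_def)
  hence "z \<in> F l" if "l < Suc j" for l using F_antimono[of l j] that by auto
  thus ?thesis using card_E_of_z_in_F[of "Suc j"] by simp
qed

text \<open>
  On the eventual image \<open>\<eta>\<close> is bijective, so there \<open>e\<close> is the only fixed point of the negation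
  \<open>t e\<close>; hence the eventual image has odd order, and it is trivial if the order of \<open>E\<close> is a
  power of two.
\<close>

lemma iter_eq_z:
  assumes card_E: "card E = 2 ^ Suc n"
    and nilpotent: "\<And>A. A \<in> E \<Longrightarrow> t e A = A \<Longrightarrow> \<exists>j. (\<eta> ^^ j) A = e"
    and P: "P \<in> E" "P \<notin> \<eta> ` E"
  shows "(\<eta> ^^ n) P = z"
proof -
  have "\<exists>j. z \<notin> F j"
  proof (rule ccontr)
    assume "\<not> ?thesis"
    \<comment> \<open>If the order were halved at every step, \<open>2 ^ card E\<close> would divide
      \<open>card E\<close>, which is smaller.\<close>
    hence "card E = 2 ^ card E * card (F (card E))" by (intro card_E_of_z_in_F) auto
    moreover have "card E > 0" using card_E by simp
    ultimately show False using less_exp[of "card E"]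
      by (metis dvd_imp_le dvd_triv_left leD)
  qed
  \<comment> \<open>\<open>j\<close> is the first index at which \<open>z\<close> has left the
    chain; from there on \<open>\<eta>\<close> is injective.\<close>
  define j where "j = (LEAST j. z \<notin> F j)"
  have j: "z \<notin> F j" and below: "\<And>l. l < j \<Longrightarrow> z \<in> F l"
    using LeastI_ex[OF \<open>\<exists>j. z \<notin> F j\<close>] not_less_Least by (auto simp: j_def)
  have "card (\<eta> ` F j) = card (F j)"
    using card_F_Suc[of j] j by (simp add: F_Suc)
  hence inj: "inj_on \<eta> (F j)" by (rule eq_card_imp_inj_on[OF finite_F])
  have stable: "\<eta> A \<in> F j" if "A \<in> F j" for A
    using that F_Suc F_Suc_subset by blast
  have e_only: "A = e" if "A \<in> F j" "(\<eta> ^^ l) A = e" for A l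
    using that
  proof (induction l arbitrary: A)
    case (Suc l)
    hence "\<eta> A = e" using stable by (metis comp_apply funpow_Suc_right)
    thus ?case using inj Suc.prems e_in_F eta_e by (metis inj_onD)
  qed simp
  have "odd (card (F j))"
  proof (rule odd_card_of_involution[where f = "t e" and e = e])
    fix A assume A: "A \<in> F j"
    hence "A \<in> E" using F_subset by blast
    thus "t e A \<in> F j" "t e (t e A) = A" using A F_t e_in_F e_in t_cancel by auto
    show "t e A = A \<longleftrightarrow> A = e" using A \<open>A \<in> E\<close> nilpotent e_only t_e_e by blast
  qed (use finite_F e_in_F in auto)
  moreover have cardE: "card E = 2 ^ j * card (F j)" using below by (rule card_E_of_z_in_F)
  ultimately have "card (F j) dvd 1"
    using card_E by (metis coprime_dvd_mult_right_iff coprime_power_right_iff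
        coprime_right_2_iff_odd dvd_triv_right mult.right_neutral)
  hence one: "card (F j) = 1" by simp
  hence jn: "j = Suc n" using cardE card_E by (metis mult.right_neutral one_less_numeral_iff
        power_inject_exp semiring_norm(76))
  \<comment> \<open>\<open>F n = {e, z}\<close> is the last nontrivial image. Hence the kernel of
    \<open>\<eta> ^^ n\<close> and the image of \<open>\<eta>\<close> both have order
    \<open>2 ^ n\<close>; as the image lies in the kernel, they coincide, and \<open>P\<close> is
    outside both.\<close>
  have "card (F n) = 2" using card_F_Suc[of n] below[of n] one jn by simp
  hence ker: "card {C \<in> E. (\<eta> ^^ n) C = e} = 2 ^ n"
    using card_E_iter_kernel[of n] card_E by simp
  have "card (\<eta> ` E) = 2 ^ n"
    using card_F_Suc[of 0] z_in card_E by (auto simp: F_def)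
  moreover have "\<eta> ` E \<subseteq> {C \<in> E. (\<eta> ^^ n) C = e}"
  proof safe
    fix A assume A: "A \<in> E"
    show "\<eta> A \<in> E" using A by (rule eta_in)
    have "(\<eta> ^^ n) (\<eta> A) \<in> F j"
      unfolding F_def jn using A by (metis comp_apply funpow_Suc_right imageI)
    thus "(\<eta> ^^ n) (\<eta> A) = e" using one e_in_F by (metis card_1_singletonE singletonD)
  qed
  ultimately have "\<eta> ` E = {C \<in> E. (\<eta> ^^ n) C = e}"
    using ker finite_E by (intro card_subset_eq) auto
  hence "(\<eta> ^^ n) P \<noteq> e" using P by blast
  moreover have "\<eta> ((\<eta> ^^ n) P) = e"
  proof -
    have "\<eta> ((\<eta> ^^ n) P) \<in> F j" unfolding F_def jn using P by auto
    thus ?thesis using one e_in_F by (metis card_1_singletonE singletonD)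
  qed
  ultimately show ?thesis using eta_eq_e_iff iter_in P by blast
qed

end

section \<open>Jacobsthal sums\<close>

locale odd_prime =
  fixes p :: int
  assumes prime_p: "prime p" and odd_p: "odd p"
begin

lemma p_gt_2: "p > 2"
  using prime_p odd_p prime_ge_2_int[of p] by (cases "p = 2") auto

abbreviation \<chi> :: "int \<Rightarrow> int" where "\<chi> a \<equiv> Legendre a p"

definition R :: "int set" where "R = {0..<p}"

lemma finite_R [simp]: "finite R" by (simp add: R_def)

lemma card_R: "int (card R) = p" using p_gt_2 by (simp add: R_def)

lemma mod_in_R [simp]: "a mod p \<in> R" using p_gt_2 by (simp add: R_def)

lemma R_cong_imp_eq: "a \<in> R \<Longrightarrow> b \<in> R \<Longrightarrow> [a = b] (mod p) \<Longrightarrow> a = b"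
  by (auto simp: R_def cong_def)

lemma R_dvd_iff: "a \<in> R \<Longrightarrow> p dvd a \<longleftrightarrow> a = 0"
  by (auto simp: R_def dest: zdvd_imp_le)

lemma QuadRes_cong: "[a = b] (mod p) \<Longrightarrow> QuadRes p a \<longleftrightarrow> QuadRes p b"
  unfolding QuadRes_def by (meson cong_sym cong_trans)

lemma chi_cong: "[a = b] (mod p) \<Longrightarrow> \<chi> a = \<chi> b"
  using QuadRes_cong[of a b] by (simp add: Legendre_def cong_def)

lemma chi_range: "\<chi> a \<in> {-1, 0, 1}" by (simp add: Legendre_def)

lemma chi_eq_0_iff: "\<chi> a = 0 \<longleftrightarrow> p dvd a" by (simp add: Legendre_def cong_0_iff)

lemma chi_euler: "[\<chi> a = a ^ ((nat p - 1) div 2)] (mod p)"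
  using euler_criterion[of "nat p" a] prime_p p_gt_2 by simp

text \<open>Euler's criterion gives the congruence modulo \<open>p\<close>; the two sides differ by
  at most 2, which is less than \<open>p\<close>.\<close>

lemma chi_mult: "\<chi> (a * b) = \<chi> a * \<chi> b"
proof -
  have "[\<chi> (a * b) = \<chi> a * \<chi> b] (mod p)"
    using chi_euler[of "a * b"] cong_sym[OF cong_mult[OF chi_euler[of a] chi_euler[of b]]]
    unfolding power_mult_distrib by (rule cong_trans)
  hence "p dvd \<chi> (a * b) - \<chi> a * \<chi> b" by (simp add: cong_iff_dvd_diff)
  moreover have "\<bar>\<chi> (a * b) - \<chi> a * \<chi> b\<bar> \<le> 2"
    using chi_range[of a] chi_range[of b] chi_range[of "a * b"] by auto
  ultimately have "\<chi> (a * b) - \<chi> a * \<chi> b = 0"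
    using p_gt_2 dvd_imp_le_int[of "\<chi> (a * b) - \<chi> a * \<chi> b" p] by linarith
  thus ?thesis by simp
qed

lemma chi_square: "\<chi> (a\<^sup>2) = (if p dvd a then 0 else 1)"
  using chi_mult[of a a] chi_range[of a] chi_eq_0_iff[of a] by (auto simp: power2_eq_square)

lemma chi_mult_self: "\<chi> a * \<chi> a = (if p dvd a then 0 else 1)"
  using chi_mult[of a a] chi_square[of a] by (simp add: power2_eq_square)

lemma square_cong_iff: "[a\<^sup>2 = b\<^sup>2] (mod p) \<longleftrightarrow> [a = b] (mod p) \<or> [a = - b] (mod p)"
proof -
  have "[a\<^sup>2 = b\<^sup>2] (mod p) \<longleftrightarrow> p dvd (a - b) * (a + b)"
    by (simp add: cong_iff_dvd_diff power2_eq_square algebra_simps)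
  thus ?thesis using prime_p by (simp add: prime_dvd_mult_iff cong_iff_dvd_diff)
qed

lemma square_roots_in_R:
  assumes "\<not> p dvd b"
  shows "{y \<in> R. [y\<^sup>2 = b\<^sup>2] (mod p)} = {b mod p, (- b) mod p}"
    and "b mod p \<noteq> (- b) mod p"
proof -
  show "{y \<in> R. [y\<^sup>2 = b\<^sup>2] (mod p)} = {b mod p, (- b) mod p}"
  proof -
    have "[y = a] (mod p) \<longleftrightarrow> y = a mod p" if "y \<in> R" for y a
      using that by (auto simp: R_def cong_def)
    thus ?thesis by (auto simp: square_cong_iff)
  qed
  show "b mod p \<noteq> (- b) mod p"
  proof
    assume "b mod p = (- b) mod p"
    hence "p dvd 2 * b" by (simp add: mod_eq_dvd_iff)
    thus False using assms prime_p p_gt_2 by (auto simp: prime_dvd_mult_iff dest: zdvd_imp_le)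
  qed
qed

text \<open>Turns the counting of solutions into character sums, both for the squaring map and for
  the points of the curve above a given \<open>x\<close>.\<close>

lemma card_square_roots: "int (card {y \<in> R. [y\<^sup>2 = a] (mod p)}) = 1 + \<chi> a"
proof (cases "QuadRes p a")
  case True
  then obtain b where b: "[b\<^sup>2 = a] (mod p)" by (auto simp: QuadRes_def)
  hence eq: "{y \<in> R. [y\<^sup>2 = a] (mod p)} = {y \<in> R. [y\<^sup>2 = b\<^sup>2] (mod p)}"
    by (auto intro: cong_trans cong_sym)
  have chi: "\<chi> a = (if p dvd b then 0 else 1)" using chi_cong[OF b] chi_square by simp
  show ?thesis
  proof (cases "p dvd b")
    case True
    hence "[b\<^sup>2 = 0] (mod p)" by (simp add: cong_0_iff power2_eq_square)
    hence "{y \<in> R. [y\<^sup>2 = b\<^sup>2] (mod p)} = {y \<in> R. p dvd y\<^sup>2}"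
      by (metis (no_types, lifting) cong_0_iff cong_sym cong_trans)
    also have "\<dots> = {0}" using prime_p p_gt_2 R_dvd_iff
      by (auto simp: prime_dvd_power_iff R_def)
    finally show ?thesis using chi True eq by simp
  next
    case False
    thus ?thesis using chi eq square_roots_in_R[OF False] by simp
  qed
next
  case False
  hence "{y \<in> R. [y\<^sup>2 = a] (mod p)} = {}" "\<not> [a = 0] (mod p)"
    using QuadRes_cong[of a 0] exI[of "\<lambda>y. [y\<^sup>2 = 0] (mod p)" 0] by (auto simp: QuadRes_def)
  thus ?thesis using False by (simp add: Legendre_def)
qed

text \<open>These are the functions on the residues modulo \<open>p\<close>, written as functions on
  integers so that arguments need not be reduced.\<close>

definition periodic :: "(int \<Rightarrow> int) \<Rightarrow> bool" where
  "periodic f \<longleftrightarrow> (\<forall>a b. [a = b] (mod p) \<longrightarrow> f a = f b)"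

text \<open>The map \<open>x \<mapsto> u x + v\<close> permutes the residues modulo
  \<open>p\<close>.\<close>

lemma sum_reindex:
  assumes "\<not> p dvd u" "periodic f"
  shows "(\<Sum>x\<in>R. f (u * x + v)) = (\<Sum>x\<in>R. f x)"
proof -
  have inj: "inj_on (\<lambda>x. (u * x + v) mod p) R"
  proof (rule inj_onI)
    fix x y assume xy: "x \<in> R" "y \<in> R" "(u * x + v) mod p = (u * y + v) mod p"
    hence "p dvd u * (x - y)" by (simp add: mod_eq_dvd_iff algebra_simps)
    thus "x = y" using xy assms(1) prime_p R_cong_imp_eq
      by (simp add: prime_dvd_mult_iff cong_iff_dvd_diff)
  qed
  have "(\<lambda>x. (u * x + v) mod p) ` R = R"
    by (rule card_subset_eq) (auto simp: card_image[OF inj])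
  hence "(\<Sum>x\<in>R. f x) = (\<Sum>x\<in>R. f ((u * x + v) mod p))"
    using sum.reindex[OF inj, of f] by simp
  moreover have "f ((u * x + v) mod p) = f (u * x + v)" for x
    using assms(2) cong_mod_left[THEN iffD2, OF cong_refl] unfolding periodic_def by blast
  ultimately show ?thesis by simp
qed

lemma periodic_poly:
  assumes "\<And>a b. [a = b] (mod p) \<Longrightarrow> [h a = h b] (mod p)"
  shows "periodic (\<lambda>a. \<chi> (h a))"
  using assms chi_cong by (auto simp: periodic_def)

text \<open>Group the \<open>u\<close> by the value \<open>n\<close> of their square, which is taken
  \<open>1 + \<chi> n\<close> times.\<close>

lemma sum_over_squares:
  assumes "periodic f"
  shows "(\<Sum>u\<in>R. f (u\<^sup>2)) = (\<Sum>n\<in>R. f n * (1 + \<chi> n))"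
proof -
  have "(\<Sum>u\<in>R. f (u\<^sup>2)) = (\<Sum>n\<in>R. \<Sum>u | u \<in> R \<and> u\<^sup>2 mod p = n. f (u\<^sup>2))"
    by (rule sum.group[symmetric]) auto
  also have "\<dots> = (\<Sum>n\<in>R. f n * (1 + \<chi> n))"
  proof (rule sum.cong[OF refl])
    fix n assume n: "n \<in> R"
    have eq: "u\<^sup>2 mod p = n \<longleftrightarrow> [u\<^sup>2 = n] (mod p)" for u
      using n by (simp add: cong_def R_def)
    have "(\<Sum>u | u \<in> R \<and> u\<^sup>2 mod p = n. f (u\<^sup>2)) = (\<Sum>u | u \<in> R \<and> [u\<^sup>2 = n] (mod p). f n)"
      using assms by (intro sum.cong) (auto simp: eq periodic_def)
    thus "(\<Sum>u | u \<in> R \<and> u\<^sup>2 mod p = n. f (u\<^sup>2)) = f n * (1 + \<chi> n)"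
      by (simp add: card_square_roots)
  qed
  finally show ?thesis .
qed

end

section \<open>Second moments of the Jacobsthal sum\<close>

locale odd_prime_nonresidue = odd_prime +
  fixes g :: int
  assumes chi_g: "\<chi> g = - 1"
begin

lemma g_not_dvd: "\<not> p dvd g" using chi_g chi_eq_0_iff[of g] by auto

text \<open>Scaling by the non-residue \<open>g\<close> permutes the residues and changes the sign
  of the sum.\<close>

lemma sum_chi: "(\<Sum>x\<in>R. \<chi> x) = 0"
proof -
  have "(\<Sum>x\<in>R. \<chi> x) = (\<Sum>x\<in>R. \<chi> (g * x + 0))"
    by (rule sum_reindex[symmetric]) (auto simp: g_not_dvd periodic_def chi_cong)
  also have "\<dots> = - (\<Sum>x\<in>R. \<chi> x)" by (simp add: chi_mult chi_g sum_negf)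
  finally show ?thesis by simp
qed

lemma sum_chi_mult_self: "(\<Sum>x\<in>R. \<chi> x * \<chi> x) = p - 1"
proof -
  have "(\<Sum>x\<in>R. \<chi> x * \<chi> x) = (\<Sum>x\<in>R - {0}. 1)"
    using R_dvd_iff by (intro sum.mono_neutral_cong_right) (auto simp: chi_mult_self)
  also have "\<dots> = p - 1" using p_gt_2 by (simp add: R_def)
  finally show ?thesis .
qed

text \<open>
  The sum over \<open>n\<close> takes the same value for all \<open>d \<noteq> 0\<close>, and the total over all \<open>d\<close> vanishes.
\<close>

lemma sum_chi_quadratic: "(\<Sum>n\<in>R. \<chi> (n * (n - d))) = (if p dvd d then p else 0) - 1"
proof -
  define T where "T d = (\<Sum>n\<in>R. \<chi> (n * (n - d)))" for d
  have T0: "T d = p - 1" if "p dvd d" for d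
  proof -
    have "\<chi> (n * (n - d)) = \<chi> n * \<chi> n" for n
      using that by (subst chi_mult, subst chi_cong[of "n - d" n]) (auto simp: cong_iff_dvd_diff)
    thus ?thesis by (simp add: T_def sum_chi_mult_self)
  qed
  have T1: "T d = T 1" if "\<not> p dvd d" for d
  proof -
    have "T d = (\<Sum>n\<in>R. \<chi> ((d * n + 0) * (d * n + 0 - d)))" unfolding T_def
      by (rule sum_reindex[OF that periodic_poly, symmetric]) (intro cong_mult cong_diff, auto)
    also have "\<dots> = (\<Sum>n\<in>R. \<chi> (d\<^sup>2) * \<chi> (n * (n - 1)))"
      by (intro sum.cong refl) (simp add: chi_mult[symmetric] power2_eq_square algebra_simps)
    also have "\<dots> = T 1" using that by (simp add: T_def chi_square)
    finally show ?thesis .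
  qed
  have "(\<Sum>d\<in>R. T d) = (\<Sum>n\<in>R. \<Sum>d\<in>R. \<chi> n * \<chi> ((- 1) * d + n))"
    unfolding T_def by (subst sum.swap) (simp add: chi_mult)
  also have "\<dots> = (\<Sum>n\<in>R. \<chi> n * (\<Sum>d\<in>R. \<chi> d))"
    unfolding sum_distrib_left[symmetric] using p_gt_2
    by (intro sum.cong refl arg_cong2[of _ _ _ _ "(*)"] sum_reindex)
      (auto simp: periodic_def chi_cong)
  also have "\<dots> = 0" by (simp add: sum_chi)
  finally have "0 = T 0 + (\<Sum>d\<in>R - {0}. T d)"
    using p_gt_2 by (subst (asm) sum.remove[of _ 0]) (auto simp: R_def)
  also have "(\<Sum>d\<in>R - {0}. T d) = (\<Sum>d\<in>R - {0}. T 1)"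
    using R_dvd_iff by (intro sum.cong refl T1) auto
  also have "\<dots> = (p - 1) * T 1" using p_gt_2 by (simp add: R_def)
  finally have "(p - 1) * (T 1 + 1) = 0" using T0[of 0] by (simp add: distrib_left)
  hence "T 1 = - 1" using p_gt_2 by simp
  thus ?thesis using T0 T1 by (auto simp: T_def[symmetric])
qed

definition \<phi> :: "int \<Rightarrow> int" where "\<phi> n = (\<Sum>x\<in>R. \<chi> (x * (x\<^sup>2 - n)))"

lemma periodic_phi: "periodic (\<lambda>n. (\<phi> (a * n))\<^sup>2)"
  unfolding periodic_def \<phi>_def
  by (intro allI impI arg_cong[of _ _ "\<lambda>x. x\<^sup>2"] sum.cong refl chi_cong cong_mult cong_diff) auto

lemma phi_0: "\<phi> 0 = 0"
proof -
  have "\<chi> (x * (x\<^sup>2 - 0)) = \<chi> x" for x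
    using chi_range[of x] by (auto simp: chi_mult power2_eq_square)
  thus ?thesis by (simp add: \<phi>_def sum_chi)
qed

text \<open>Substituting \<open>u x\<close> for \<open>x\<close> takes out the factor
  \<open>u^3\<close>, and \<open>\<chi>\<close> does not see its square part. If \<open>p\<close>
  divides \<open>u\<close>, both sides vanish by \<open>phi_0\<close>.\<close>

lemma phi_mult_square: "\<phi> (n * u\<^sup>2) = \<chi> u * \<phi> n"
proof (cases "p dvd u")
  case True
  hence "\<phi> (n * u\<^sup>2) = \<phi> 0" unfolding \<phi>_def
    by (intro sum.cong refl chi_cong cong_mult cong_diff) (auto simp: cong_0_iff power2_eq_square)
  thus ?thesis using True chi_eq_0_iff[of u] phi_0 by simp
next
  case False
  have "\<phi> (n * u\<^sup>2) = (\<Sum>x\<in>R. \<chi> ((u * x + 0) * ((u * x + 0)\<^sup>2 - n * u\<^sup>2)))"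
    unfolding \<phi>_def
    by (rule sum_reindex[OF False periodic_poly, symmetric])
       (intro cong_mult cong_diff cong_pow, auto)
  also have "\<dots> = (\<Sum>x\<in>R. \<chi> u * \<chi> (u\<^sup>2) * \<chi> (x * (x\<^sup>2 - n)))"
    by (intro sum.cong refl) (simp add: chi_mult[symmetric] power2_eq_square algebra_simps)
  also have "\<dots> = \<chi> u * \<phi> n"
    using False by (simp add: \<phi>_def chi_square sum_distrib_left)
  finally show ?thesis .
qed

text \<open>Expand the square and sum over \<open>n\<close> first: by
  \<open>sum_chi_quadratic\<close> the inner sum is \<open>- 1\<close>, with an extra
  \<open>p\<close> when \<open>x^2 = y^2\<close>. The terms with \<open>- 1\<close> cancel by
  \<open>sum_chi\<close>, and only \<open>y = x\<close> and \<open>y = - x\<close> remain.\<close>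

lemma sum_phi_square:
  assumes "\<chi> (- 1) = 1"
  shows "(\<Sum>n\<in>R. (\<phi> n)\<^sup>2) = 2 * p * (p - 1)"
proof -
  have "(\<phi> n)\<^sup>2 = (\<Sum>x\<in>R. \<Sum>y\<in>R. \<chi> x * \<chi> y * \<chi> ((x\<^sup>2 - n) * (y\<^sup>2 - n)))" for n
  proof -
    have "(\<phi> n)\<^sup>2 = \<phi> n * \<phi> n" by (rule power2_eq_square)
    also have "\<dots> = (\<Sum>x\<in>R. \<Sum>y\<in>R. \<chi> x * \<chi> y * \<chi> ((x\<^sup>2 - n) * (y\<^sup>2 - n)))"
      unfolding \<phi>_def sum_product by (intro sum.cong refl) (simp add: chi_mult)
    finally show ?thesis .
  qed
  hence "(\<Sum>n\<in>R. (\<phi> n)\<^sup>2) = (\<Sum>n\<in>R. \<Sum>x\<in>R. \<Sum>y\<in>R. \<chi> x * \<chi> y * \<chi> ((x\<^sup>2 - n) * (y\<^sup>2 - n)))"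
    by simp
  also have "\<dots> = (\<Sum>x\<in>R. \<Sum>n\<in>R. \<Sum>y\<in>R. \<chi> x * \<chi> y * \<chi> ((x\<^sup>2 - n) * (y\<^sup>2 - n)))"
    by (rule sum.swap)
  also have "\<dots> = (\<Sum>x\<in>R. \<Sum>y\<in>R. \<Sum>n\<in>R. \<chi> x * \<chi> y * \<chi> ((x\<^sup>2 - n) * (y\<^sup>2 - n)))"
    by (rule sum.cong[OF refl], rule sum.swap)
  also have "\<dots> = (\<Sum>x\<in>R. \<Sum>y\<in>R. \<chi> x * \<chi> y * ((if p dvd x\<^sup>2 - y\<^sup>2 then p else 0) - 1))"
  proof (intro sum.cong refl)
    fix x y
    \<comment> \<open>Replacing \<open>n\<close> by \<open>x^2 - n\<close> brings the summand into
      the form of \<open>sum_chi_quadratic\<close> with \<open>d = x^2 - y^2\<close>.\<close>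
    have "(\<Sum>n\<in>R. \<chi> ((x\<^sup>2 - n) * (y\<^sup>2 - n)))
        = (\<Sum>n\<in>R. \<chi> ((x\<^sup>2 - (- 1 * n + x\<^sup>2)) * (y\<^sup>2 - (- 1 * n + x\<^sup>2))))"
      using p_gt_2
      by (intro sum_reindex[symmetric] periodic_poly cong_mult cong_diff) auto
    also have "\<dots> = (\<Sum>n\<in>R. \<chi> (n * (n - (x\<^sup>2 - y\<^sup>2))))" by (simp add: algebra_simps)
    finally show "(\<Sum>n\<in>R. \<chi> x * \<chi> y * \<chi> ((x\<^sup>2 - n) * (y\<^sup>2 - n)))
        = \<chi> x * \<chi> y * ((if p dvd x\<^sup>2 - y\<^sup>2 then p else 0) - 1)"
      by (simp add: sum_chi_quadratic flip: sum_distrib_left)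
  qed
  also have "\<dots> = (\<Sum>x\<in>R. p * (\<Sum>y\<in>R. if [y\<^sup>2 = x\<^sup>2] (mod p) then \<chi> (x * y) else 0)
      - \<chi> x * (\<Sum>y\<in>R. \<chi> y))"
    unfolding sum_distrib_left sum_subtractf[symmetric]
    by (intro sum.cong refl)
       (auto simp: chi_mult cong_iff_dvd_diff dvd_diff_commute algebra_simps)
  also have "\<dots> = (\<Sum>x\<in>R. p * (2 * (\<chi> x * \<chi> x)))"
  proof (intro sum.cong refl)
    fix x
    have "(\<Sum>y\<in>R. if [y\<^sup>2 = x\<^sup>2] (mod p) then \<chi> (x * y) else 0)
        = (\<Sum>y | y \<in> R \<and> [y\<^sup>2 = x\<^sup>2] (mod p). \<chi> (x * y))"
      by (simp add: sum.inter_filter)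
    also have "\<dots> = 2 * (\<chi> x * \<chi> x)"
    proof (cases "p dvd x")
      case True
      thus ?thesis using chi_eq_0_iff[of x] by (simp add: chi_mult)
    next
      case False
      \<comment> \<open>Since \<open>\<chi> (- 1) = 1\<close>, the two roots \<open>x\<close> and
        \<open>- x\<close> contribute equally.\<close>
      have "\<chi> (x mod p) = \<chi> x" "\<chi> ((- x) mod p) = \<chi> (- 1 * x)"
        by (rule chi_cong, simp add: cong_def)+
      hence "\<chi> (x mod p) = \<chi> x" "\<chi> ((- x) mod p) = \<chi> x"
        using assms by (simp_all only: chi_mult mult_1)
      thus ?thesis using square_roots_in_R[OF False] by (simp add: chi_mult)
    qed
    finally show "p * (\<Sum>y\<in>R. if [y\<^sup>2 = x\<^sup>2] (mod p) then \<chi> (x * y) else 0) - \<chi> x * (\<Sum>y\<in>R. \<chi> y)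
        = p * (2 * (\<chi> x * \<chi> x))" by (simp add: sum_chi)
  qed
  also have "\<dots> = 2 * p * (p - 1)"
    by (simp add: sum_chi_mult_self flip: sum_distrib_left)
  finally show ?thesis .
qed

text \<open>By \<open>phi_mult_square\<close> the square of \<open>\<phi>\<close> is constant on
  each of the two classes of nonzero residues modulo squares. They are represented by
  \<open>m\<close> and \<open>g * m\<close> and have \<open>(p - 1) / 2\<close> elements each, so
  \<open>sum_phi_square\<close> determines the sum of the two values.\<close>

lemma phi_square_sum:
  assumes "\<chi> (- 1) = 1" "\<not> p dvd m"
  shows "(\<phi> m)\<^sup>2 + (\<phi> (g * m))\<^sup>2 = 4 * p"
proof -
  have scaled: "(p - 1) * (\<phi> a)\<^sup>2 = (\<Sum>n\<in>R. (\<phi> (a * n))\<^sup>2 * (1 + \<chi> n))" for a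
  proof -
    have "(p - 1) * (\<phi> a)\<^sup>2 = (\<Sum>u\<in>R. \<chi> u * \<chi> u * (\<phi> a)\<^sup>2)"
      by (simp add: sum_chi_mult_self flip: sum_distrib_right)
    also have "\<dots> = (\<Sum>u\<in>R. (\<phi> (a * u\<^sup>2))\<^sup>2)"
      unfolding phi_mult_square by (simp add: power2_eq_square ac_simps)
    also have "\<dots> = (\<Sum>n\<in>R. (\<phi> (a * n))\<^sup>2 * (1 + \<chi> n))"
      by (rule sum_over_squares[OF periodic_phi])
    finally show ?thesis .
  qed
  \<comment> \<open>Multiplication by \<open>g\<close> turns the weight \<open>1 + \<chi> n\<close>
    into \<open>1 - \<chi> n\<close>; added to the weight for \<open>m\<close> it gives 2.\<close>
  have "(p - 1) * (\<phi> (g * m))\<^sup>2 = (\<Sum>n\<in>R. (\<phi> (m * (g * n + 0)))\<^sup>2 * (1 - \<chi> (g * n + 0)))"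
    unfolding scaled[of "g * m"] by (simp add: chi_mult chi_g algebra_simps)
  also have "\<dots> = (\<Sum>n\<in>R. (\<phi> (m * n))\<^sup>2 * (1 - \<chi> n))"
  proof (rule sum_reindex[OF g_not_dvd], unfold periodic_def, intro allI impI)
    fix a b :: int assume "[a = b] (mod p)"
    thus "(\<phi> (m * a))\<^sup>2 * (1 - \<chi> a) = (\<phi> (m * b))\<^sup>2 * (1 - \<chi> b)"
      using periodic_phi[of m] chi_cong[of a b] unfolding periodic_def by presburger
  qed
  finally have "(p - 1) * ((\<phi> m)\<^sup>2 + (\<phi> (g * m))\<^sup>2) = (\<Sum>n\<in>R. 2 * (\<phi> (m * n + 0))\<^sup>2)"
    unfolding distrib_left scaled[of m]
    by (simp add: algebra_simps flip: sum.distrib)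
  also have "\<dots> = 2 * (\<Sum>n\<in>R. (\<phi> n)\<^sup>2)"
    unfolding sum_distrib_left[symmetric]
    using sum_reindex[OF assms(2), of "\<lambda>n. (\<phi> n)\<^sup>2" 0] periodic_phi[of 1] by simp
  also have "\<dots> = (p - 1) * (4 * p)" using sum_phi_square[OF assms(1)] by simp
  finally show ?thesis using p_gt_2 by simp
qed

end

section \<open>The curve modulo a prime\<close>

lemma ec_affine_eq_iff:
  "ec_affine n x y = ec_affine n x' y' \<longleftrightarrow> [x = x'] (mod n) \<and> [y = y'] (mod n)"
  by (simp add: ec_affine_def cong_def)

text \<open>
  Here \<open>c = 1 / (1 + i)\<close>. A point \<open>(x, y)\<close> with \<open>x \<noteq> 0\<close> is described by \<open>x\<close> and
  \<open>q = y / ((1 + i) x)\<close>, the slope of the chord through \<open>(x, y)\<close> and \<open>[i](x, y)\<close>. In these terms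
  the curve is \<open>x\<^sup>2 - 2 i q\<^sup>2 x - m = 0\<close> and \<open>\<eta>\<close> maps the point to \<open>(q\<^sup>2, - q (q\<^sup>2 + i x))\<close>.
\<close>

lemma ec_affine_neq_Infinity [simp]: "ec_affine n x y \<noteq> Infinity" "Infinity \<noteq> ec_affine n x y"
  by (simp_all add: ec_affine_def)

lemmas poly_simps = algebra_simps power2_eq_square power3_eq_cube

locale eta_curve = odd_prime +
  fixes m i s c :: int
  assumes i_square: "p dvd i\<^sup>2 + 1" and s_square: "p dvd s\<^sup>2 - m"
    and c_inverse: "p dvd c * (1 + i) - 1" and m_unit: "\<not> p dvd m"
begin

lemma dvd_mult_iff: "p dvd a * b \<longleftrightarrow> p dvd a \<or> p dvd b"
  using prime_p by (simp add: prime_dvd_mult_iff)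

lemma not_dvd_2: "\<not> p dvd 2"
  using p_gt_2 by (auto dest: zdvd_imp_le)

text \<open>As \<open>(1 + i)^2 = 2 i\<close>, \<open>c^2\<close> is the inverse of
  \<open>2 i\<close>, which is also \<open>- i / 2\<close>.\<close>

lemma c_facts: "p dvd 2 * i * c\<^sup>2 - 1" "p dvd 4 * (c\<^sup>2)\<^sup>2 + 1" "p dvd 2 * c\<^sup>2 + i"
proof -
  have "2 * i * c\<^sup>2 - 1 = (1 + c * i - c * i\<^sup>2) * (c * (1 + i) - 1) + (c\<^sup>2 * i - c) * (i\<^sup>2 + 1)"
    by (simp add: poly_simps)
  thus 1: "p dvd 2 * i * c\<^sup>2 - 1"
    using i_square c_inverse by simp
  have "2 * c\<^sup>2 + i = (- i) * (2 * i * c\<^sup>2 - 1) + 2 * c\<^sup>2 * (i\<^sup>2 + 1)" by (simp add: poly_simps)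
  thus "p dvd 2 * c\<^sup>2 + i" using 1 i_square dvd_add dvd_mult by metis
  have "4 * (c\<^sup>2)\<^sup>2 + 1 = (- 2 * c\<^sup>2 * i - 1) * (2 * i * c\<^sup>2 - 1) + 4 * (c\<^sup>2)\<^sup>2 * (i\<^sup>2 + 1)"
    by (simp add: poly_simps)
  thus "p dvd 4 * (c\<^sup>2)\<^sup>2 + 1" using 1 i_square dvd_add dvd_mult by metis
qed

section \<open>Points, lines and collinear triples modulo \<open>p\<close>\<close>

definition on_curve :: "int \<Rightarrow> int \<Rightarrow> bool" where
  "on_curve x y \<longleftrightarrow> p dvd y\<^sup>2 - (x ^ 3 - m * x)"

lemma on_curve_cong:
  "[x = x'] (mod p) \<Longrightarrow> [y = y'] (mod p) \<Longrightarrow> on_curve x y \<longleftrightarrow> on_curve x' y'"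
  unfolding on_curve_def by (intro cong_dvd_iff cong_diff cong_pow cong_mult) auto

definition E :: "ec_point set" where
  "E = insert Infinity {ec_affine p x y | x y. on_curve x y}"

lemma affine_in_E_iff: "ec_affine p x y \<in> E \<longleftrightarrow> on_curve x y"
proof
  assume "ec_affine p x y \<in> E"
  thus "on_curve x y" using on_curve_cong by (auto simp: E_def ec_affine_eq_iff)
qed (auto simp: E_def)

lemma Infinity_in_E: "Infinity \<in> E"
  by (simp add: E_def)

lemma E_cases:
  assumes "A \<in> E"
  obtains "A = Infinity" | x y where "A = ec_affine p x y" "on_curve x y"
  using assms by (auto simp: E_def)

text \<open>The conditions state that \<open>X\<^sup>3 - m X - (l X + v)\<^sup>2\<close> has the roots \<open>x1, x2, x3\<close>.\<close>

definition line :: "int \<Rightarrow> int \<Rightarrow> int \<Rightarrow> int \<Rightarrow> int \<Rightarrow> int \<Rightarrow> int \<Rightarrow> int \<Rightarrow> bool" where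
  "line l v x1 y1 x2 y2 x3 y3 \<longleftrightarrow>
     p dvd y1 - (l * x1 + v) \<and> p dvd y2 - (l * x2 + v) \<and> p dvd y3 - (l * x3 + v) \<and>
     p dvd x1 + x2 + x3 - l\<^sup>2 \<and> p dvd x1 * x2 + x1 * x3 + x2 * x3 + m + 2 * l * v \<and>
     p dvd x1 * x2 * x3 - v\<^sup>2"

lemma lineD:
  assumes "line l v x1 y1 x2 y2 x3 y3"
  shows "p dvd y1 - (l * x1 + v)" "p dvd y2 - (l * x2 + v)" "p dvd y3 - (l * x3 + v)"
    "p dvd x1 + x2 + x3 - l\<^sup>2" "p dvd x1 * x2 + x1 * x3 + x2 * x3 + m + 2 * l * v"
    "p dvd x1 * x2 * x3 - v\<^sup>2"
  using assms by (simp_all add: line_def)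

lemma line_cong:
  assumes "[x1 = x1'] (mod p)" "[y1 = y1'] (mod p)" "[x2 = x2'] (mod p)" "[y2 = y2'] (mod p)"
    "[x3 = x3'] (mod p)" "[y3 = y3'] (mod p)"
  shows "line l v x1 y1 x2 y2 x3 y3 \<longleftrightarrow> line l v x1' y1' x2' y2' x3' y3'"
  unfolding line_def
  by (intro conj_cong cong_dvd_iff cong_diff cong_add cong_mult assms cong_refl)

lemma line_swap:
  "line l v x1 y1 x2 y2 x3 y3 \<Longrightarrow> line l v x2 y2 x1 y1 x3 y3"
  "line l v x1 y1 x2 y2 x3 y3 \<Longrightarrow> line l v x1 y1 x3 y3 x2 y2"
  unfolding line_def by (auto simp: algebra_simps)

lemma line_on_curve:
  assumes "line l v x1 y1 x2 y2 x3 y3"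
  shows "on_curve x1 y1" "on_curve x2 y2" "on_curve x3 y3"
proof -
  have "on_curve x1 y1" if "line l v x1 y1 x2 y2 x3 y3" for x1 y1 x2 y2 x3 y3
  proof -
    \<comment> \<open>Here and below a congruence is proved by writing its difference as an explicit
      polynomial combination of terms already known to be divisible by \<open>p\<close>.\<close>
    have "y1\<^sup>2 - (x1 ^ 3 - m * x1) = (l * x1 + y1 + v) * (y1 - (l * x1 + v))
      + (- x1\<^sup>2) * (x1 + x2 + x3 - l\<^sup>2) + x1 * (x1 * x2 + x1 * x3 + x2 * x3 + m + 2 * l * v)
      + (- 1) * (x1 * x2 * x3 - v\<^sup>2)" by (simp add: poly_simps)
    moreover have "p dvd \<dots>" by (rule lineD[OF that] | rule dvd_add | rule dvd_mult)+
    ultimately show ?thesis unfolding on_curve_def by metis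
  qed
  thus "on_curve x1 y1" "on_curve x2 y2" "on_curve x3 y3"
    using assms line_swap(1)[OF assms] line_swap(1)[OF line_swap(2)[OF assms]] by blast+
qed

text \<open>The derivative of the cubic \<open>X^3 - m X - (l X + v)^2\<close> vanishes at its
  double root \<open>x\<close>.\<close>

lemma line_tangent:
  assumes "line l v x y x y x3 y3"
  shows "p dvd 3 * x\<^sup>2 - m - 2 * l * y"
proof -
  have "3 * x\<^sup>2 - m - 2 * l * y = (- 2 * l) * (y - (l * x + v)) + 2 * x * (x + x + x3 - l\<^sup>2)
    + (- 1) * (x * x + x * x3 + x * x3 + m + 2 * l * v)" by (simp add: poly_simps)
  moreover have "p dvd \<dots>" by (rule lineD[OF assms] | rule dvd_add | rule dvd_mult)+
  ultimately show ?thesis by metis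
qed

text \<open>A \<open>line\<close> has a slope and so is never vertical. A slope at a point with
  \<open>y = 0\<close> would give \<open>3 x^2 = m\<close> by \<open>line_tangent\<close>; the curve
  equation then gives \<open>2 m x = 0\<close>, so \<open>p\<close> divides \<open>x\<close> and
  finally \<open>m\<close>.\<close>

lemma line_same_x:
  assumes "line l v x1 y1 x2 y2 x3 y3" "[x1 = x2] (mod p)"
  shows "[y1 = y2] (mod p)" "\<not> p dvd y1"
proof -
  have "y1 - y2 = (y1 - (l * x1 + v)) - (y2 - (l * x2 + v)) + l * (x1 - x2)" by (simp add: poly_simps)
  moreover have "p dvd \<dots>"
    by (rule lineD[OF assms(1)] assms(2)[unfolded cong_iff_dvd_diff]
        | rule dvd_add | rule dvd_diff | rule dvd_mult)+
  ultimately have "p dvd y1 - y2" by metis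
  thus y: "[y1 = y2] (mod p)" by (simp add: cong_iff_dvd_diff)
  show "\<not> p dvd y1"
  proof
    assume y1: "p dvd y1"
    have "line l v x1 y1 x1 y1 x3 y3"
      using assms y line_cong[of x1 x1 y1 y1 x2 x1 y2 y1 x3 x3 y3 y3 l v] cong_sym by auto
    hence "p dvd 3 * x1\<^sup>2 - m - 2 * l * y1" by (rule line_tangent)
    hence "p dvd (3 * x1\<^sup>2 - m - 2 * l * y1) + 2 * l * y1" using y1 by (intro dvd_add dvd_mult)
    hence t: "p dvd 3 * x1\<^sup>2 - m" by simp
    have "2 * m * x1 = 3 * (y1\<^sup>2 - (x1 ^ 3 - m * x1)) + (- 3 * y1) * y1 + x1 * (3 * x1\<^sup>2 - m)"
      by (simp add: poly_simps)
    moreover have "p dvd \<dots>"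
      by (rule line_on_curve(1)[OF assms(1), unfolded on_curve_def] t y1 | rule dvd_add | rule dvd_mult)+
    ultimately have "p dvd 2 * m * x1" by metis
    hence "p dvd x1" using m_unit not_dvd_2 by (simp only: dvd_mult_iff) blast
    hence "p dvd 3 * x1 * x1 - (3 * x1\<^sup>2 - m)" using t by (metis dvd_diff dvd_mult)
    hence "p dvd m" by (simp add: power2_eq_square)
    thus False using m_unit by blast
  qed
qed

lemma line_unique:
  assumes L: "line l v x1 y1 x2 y2 x3 y3" and K: "line k w x1 y1 x2 y2 x y"
  shows "[x3 = x] (mod p)" "[y3 = y] (mod p)"
proof -
  \<comment> \<open>It is enough that the slopes agree: intercept and third point follow from them.
    The slope is that of the tangent or of the chord.\<close>
  have lk: "p dvd l - k"
  proof (cases "[x1 = x2] (mod p)")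
    case True
    hence y: "[y1 = y2] (mod p)" "\<not> p dvd y1" using line_same_x[OF L] by auto
    have "line l v x1 y1 x1 y1 x3 y3" "line k w x1 y1 x1 y1 x y"
      using L K line_cong[OF cong_refl cong_refl True[THEN cong_sym] y(1)[THEN cong_sym] cong_refl cong_refl]
      by auto
    from this[THEN line_tangent]
    have "p dvd (3 * x1\<^sup>2 - m - 2 * k * y1) - (3 * x1\<^sup>2 - m - 2 * l * y1)" by (rule dvd_diff[rotated])
    also have "\<dots> = 2 * (l - k) * y1" by (simp add: poly_simps)
    finally show ?thesis using y not_dvd_2 by (simp only: dvd_mult_iff) blast
  next
    case False
    have "(x1 - x2) * (l - k) = (y2 - (l * x2 + v)) - (y1 - (l * x1 + v))
      + (y1 - (k * x1 + w)) - (y2 - (k * x2 + w))" by (simp add: poly_simps)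
    moreover have "p dvd \<dots>" by (rule lineD[OF L] lineD[OF K] | rule dvd_add | rule dvd_diff)+
    ultimately have "p dvd (x1 - x2) * (l - k)" by metis
    thus ?thesis using False by (simp only: dvd_mult_iff cong_iff_dvd_diff) blast
  qed
  have "v - w = (y1 - (k * x1 + w)) - (y1 - (l * x1 + v)) - x1 * (l - k)" by (simp add: poly_simps)
  moreover have "p dvd \<dots>" by (rule lineD[OF L] lineD[OF K] lk | rule dvd_diff | rule dvd_mult)+
  ultimately have vw: "p dvd v - w" by metis
  have "x3 - x = (x1 + x2 + x3 - l\<^sup>2) - (x1 + x2 + x - k\<^sup>2) + (l + k) * (l - k)" by (simp add: poly_simps)
  moreover have "p dvd \<dots>" 
    by (rule lineD[OF L] lineD[OF K] lk | rule dvd_add | rule dvd_diff | rule dvd_mult)+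
  ultimately have x: "p dvd x3 - x" by metis
  have "y3 - y = (y3 - (l * x3 + v)) - (y - (k * x + w)) + (l * (x3 - x) + x * (l - k) + (v - w))"
    by (simp add: poly_simps)
  moreover have "p dvd \<dots>" 
    by (rule lineD[OF L] lineD[OF K] lk x vw | rule dvd_add | rule dvd_diff | rule dvd_mult)+
  ultimately have "p dvd y3 - y" by metis
  thus "[x3 = x] (mod p)" "[y3 = y] (mod p)" using x by (simp_all add: cong_iff_dvd_diff)
qed

lemma inverse_exists:
  assumes "\<not> p dvd a"
  obtains b where "p dvd a * b - 1"
proof -
  have "coprime a p" using assms prime_p by (metis coprime_commute prime_imp_coprime)
  hence "[a * modular_inverse p a = 1] (mod p)" by (rule cong_modular_inverse1)
  thus ?thesis using that by (simp add: cong_iff_dvd_diff)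
qed

lemma line_exists:
  assumes on: "on_curve x1 y1" "on_curve x2 y2"
    and "\<not> ([x1 = x2] (mod p) \<and> [y1 = - y2] (mod p))"
  obtains l v x3 y3 where "line l v x1 y1 x2 y2 x3 y3"
proof -
  note on' = on[unfolded on_curve_def]
  \<comment> \<open>Choosing \<open>x3\<close> by the sum condition leaves two conditions, and the
    one on the product follows from the other because \<open>x1\<close> is a root of the
    cubic.\<close>
  have finish: thesis if l: "p dvd y1 - (l * x1 + v)" "p dvd y2 - (l * x2 + v)"
      and "p dvd x1 * x2 + x1 * (l\<^sup>2 - x1 - x2) + x2 * (l\<^sup>2 - x1 - x2) + m + 2 * l * v" for l v
  proof -
    define x3 where "x3 = l\<^sup>2 - x1 - x2"
    have "x1 * x2 * x3 - v\<^sup>2 = (l * x1 + y1 + v) * (y1 - (l * x1 + v))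
      + (- 1) * (y1\<^sup>2 - (x1 ^ 3 - m * x1)) + x1 * (x1 * x2 + x1 * x3 + x2 * x3 + m + 2 * l * v)"
      unfolding x3_def by (simp add: poly_simps)
    moreover have "p dvd \<dots>"
      by (rule that[folded x3_def] on' | rule dvd_add | rule dvd_mult)+
    ultimately have "line l v x1 y1 x2 y2 x3 (l * x3 + v)"
      unfolding line_def using that by (auto simp: x3_def)
    thus ?thesis by (rule \<open>\<And>l v x3 y3. line l v x1 y1 x2 y2 x3 y3 \<Longrightarrow> thesis\<close>)
  qed
  show ?thesis
  proof (cases "p dvd x1 - x2")
    case False
    then obtain n where n: "p dvd (x1 - x2) * n - 1" by (rule inverse_exists)
    define l where "l = (y1 - y2) * n"
    define v where "v = y1 - l * x1"
    have 1: "p dvd y1 - (l * x1 + v)" by (simp add: v_def)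
    have "y2 - (l * x2 + v) = (y1 - y2) * ((x1 - x2) * n - 1)" unfolding v_def l_def by (simp add: poly_simps)
    hence 2: "p dvd y2 - (l * x2 + v)" using n by simp
    \<comment> \<open>Up to sign this is the difference of the values of the cubic at
      \<open>x1\<close> and \<open>x2\<close>, which both vanish.\<close>
    have "(x1 - x2) * (x1 * x2 + x1 * (l\<^sup>2 - x1 - x2) + x2 * (l\<^sup>2 - x1 - x2) + m + 2 * l * v)
      = (- l * x1 - y1 - v) * (y1 - (l * x1 + v)) + (l * x2 + y2 + v) * (y2 - (l * x2 + v))
      + (y1\<^sup>2 - (x1 ^ 3 - m * x1)) + (- 1) * (y2\<^sup>2 - (x2 ^ 3 - m * x2))" by (simp add: poly_simps)
    moreover have "p dvd \<dots>"
      by (rule on' 1 2 | rule dvd_add | rule dvd_mult)+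
    ultimately show ?thesis using False finish[OF 1 2] by (metis dvd_mult_iff)
  next
    case x: True
    \<comment> \<open>Over the same \<open>x\<close> the ordinates agree up to sign. Opposite ones
      are excluded, so the line is the tangent and \<open>2 * y1\<close> is invertible.\<close>
    have "(y1 - y2) * (y1 + y2) = (y1\<^sup>2 - (x1 ^ 3 - m * x1)) - (y2\<^sup>2 - (x2 ^ 3 - m * x2))
      + (x1\<^sup>2 + x1 * x2 + x2\<^sup>2 - m) * (x1 - x2)" by (simp add: poly_simps)
    moreover have "p dvd \<dots>"
      by (rule on' x | rule dvd_add | rule dvd_diff | rule dvd_mult)+
    ultimately have "p dvd (y1 - y2) * (y1 + y2)" by metis
    hence y: "p dvd y1 - y2" "\<not> p dvd y1 + y2"
      using assms(3) x by (auto simp: dvd_mult_iff cong_iff_dvd_diff)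
    have "2 * y1 = (y1 - y2) + (y1 + y2)" by simp
    hence "\<not> p dvd 2 * y1" using y by (metis dvd_add_right_iff)
    then obtain n where n: "p dvd (2 * y1) * n - 1" by (rule inverse_exists)
    define l where "l = (3 * x1\<^sup>2 - m) * n"
    define v where "v = y1 - l * x1"
    have 1: "p dvd y1 - (l * x1 + v)" by (simp add: v_def)
    have "y2 - (l * x2 + v) = l * (x1 - x2) - (y1 - y2)" unfolding v_def by (simp add: poly_simps)
    moreover have "p dvd \<dots>" by (rule x y | rule dvd_diff | rule dvd_mult)+
    ultimately have 2: "p dvd y2 - (l * x2 + v)" by metis
    have "x1 * x2 + x1 * (l\<^sup>2 - x1 - x2) + x2 * (l\<^sup>2 - x1 - x2) + m + 2 * l * v
      = (2 * x1 + x2 - l\<^sup>2) * (x1 - x2) + (- 2 * l) * (y1 - (l * x1 + v))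
        + (3 * x1\<^sup>2 - m) * ((2 * y1) * n - 1)"
      unfolding l_def by (simp add: poly_simps)
    moreover have "p dvd \<dots>" by (rule x 1 n | rule dvd_add | rule dvd_mult)+
    ultimately show ?thesis using finish[OF 1 2] by metis
  qed
qed

fun neg :: "ec_point \<Rightarrow> ec_point" where
  "neg Infinity = Infinity"
| "neg (Affine x y) = ec_affine p x (- y)"

lemma neg_affine: "neg (ec_affine p x y) = ec_affine p x (- y)"
  by (simp add: ec_affine_def mod_minus_eq)

lemma neg_in_E: "A \<in> E \<Longrightarrow> neg A \<in> E"
  by (erule E_cases) (auto simp: neg_affine affine_in_E_iff on_curve_def, simp add: E_def)

lemma neg_neg: "A \<in> E \<Longrightarrow> neg (neg A) = A"
  by (erule E_cases) (auto simp: neg_affine)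

text \<open>This is the relation \<open>A + B + C = \<infinity>\<close> of the group law in
  geometric form: the first three alternatives are the vertical lines and the line at
  infinity.\<close>

definition col :: "ec_point \<Rightarrow> ec_point \<Rightarrow> ec_point \<Rightarrow> bool" where
  "col A B C \<longleftrightarrow> A \<in> E \<and> B \<in> E \<and> C \<in> E \<and>
     (A = Infinity \<and> C = neg B \<or> B = Infinity \<and> C = neg A \<or> C = Infinity \<and> B = neg A \<or>
      (\<exists>l v x1 y1 x2 y2 x3 y3. A = ec_affine p x1 y1 \<and> B = ec_affine p x2 y2 \<and>
         C = ec_affine p x3 y3 \<and> line l v x1 y1 x2 y2 x3 y3))"

lemma col_swap:
  assumes "col A B C"
  shows "col B A C" "col A C B"
  using assms unfolding col_def by (auto simp: neg_neg; metis line_swap)+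

lemma neg_eq_Infinity_iff: "A \<in> E \<Longrightarrow> neg A = Infinity \<longleftrightarrow> A = Infinity"
  by (erule E_cases) (auto simp: neg_affine)

lemma col_Infinity: "col Infinity B C \<longleftrightarrow> B \<in> E \<and> C = neg B"
  using neg_in_E neg_neg neg_eq_Infinity_iff Infinity_in_E unfolding col_def by auto

text \<open>The choice of representatives does not matter, by \<open>line_cong\<close>. No
  \<open>line\<close> joins opposite points: their ordinates would be equal as well, hence zero,
  against \<open>line_same_x\<close>.\<close>

lemma col_affine:
  assumes "on_curve x1 y1" "on_curve x2 y2"
  shows "col (ec_affine p x1 y1) (ec_affine p x2 y2) C \<longleftrightarrow>
    (if [x1 = x2] (mod p) \<and> [y1 = - y2] (mod p) then C = Infinity
     else \<exists>l v x3 y3. C = ec_affine p x3 y3 \<and> line l v x1 y1 x2 y2 x3 y3)"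
proof -
  have "\<not> line l v x1 y1 x2 y2 x3 y3" if "[x1 = x2] (mod p)" "[y1 = - y2] (mod p)" for l v x3 y3
  proof
    assume L: "line l v x1 y1 x2 y2 x3 y3"
    have "p dvd (y1 - y2) + (y1 + y2)"
      
      using line_same_x(1)[OF L that(1)] that(2) by (intro dvd_add[of p "y1 - y2" "y1 + y2"])
        (simp_all add: cong_iff_dvd_diff)
    hence "p dvd 2 * y1" by simp
    thus False using line_same_x(2)[OF L that(1)] not_dvd_2 by (simp only: dvd_mult_iff) blast
  qed
  moreover have neg: "ec_affine p x2 y2 = neg (ec_affine p x1 y1)
      \<longleftrightarrow> [x1 = x2] (mod p) \<and> [y1 = - y2] (mod p)"
    by (auto simp: neg_affine ec_affine_eq_iff cong_sym_eq[of x2] cong_minus_minus_iff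
        dest: cong_minus_minus_iff[THEN iffD2])
       (metis cong_minus_minus_iff cong_sym minus_minus)+
  moreover have ex: "(\<exists>l v X1 Y1 X2 Y2 x3 y3. ec_affine p x1 y1 = ec_affine p X1 Y1 \<and>
      ec_affine p x2 y2 = ec_affine p X2 Y2 \<and> C = ec_affine p x3 y3 \<and> line l v X1 Y1 X2 Y2 x3 y3)
    \<longleftrightarrow> (\<exists>l v x3 y3. C = ec_affine p x3 y3 \<and> line l v x1 y1 x2 y2 x3 y3)"
    (is "?a \<longleftrightarrow> ?b")
  proof
    assume ?a
    then obtain l v X1 Y1 X2 Y2 x3 y3 where *: "ec_affine p x1 y1 = ec_affine p X1 Y1"
      "ec_affine p x2 y2 = ec_affine p X2 Y2" "C = ec_affine p x3 y3" "line l v X1 Y1 X2 Y2 x3 y3"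
      by blast
    have "line l v x1 y1 x2 y2 x3 y3"
      using *(4) line_cong[of x1 X1 y1 Y1 x2 X2 y2 Y2 x3 x3 y3 y3] *(1,2)
      by (simp add: ec_affine_eq_iff)
    thus ?b using *(3) by blast
  qed blast
  moreover have "C \<in> E" if "C = ec_affine p x3 y3" "line l v x1 y1 x2 y2 x3 y3" for l v x3 y3
    using that line_on_curve(3) affine_in_E_iff by simp
  ultimately show ?thesis
    unfolding col_def neg ex using assms affine_in_E_iff Infinity_in_E by simp blast
qed

lemma ex1_col:
  assumes "A \<in> E" "B \<in> E"
  shows "\<exists>!C. col A B C"
proof (cases "A = Infinity \<or> B = Infinity")
  case True
  thus ?thesis using assms col_Infinity col_swap by metis
next
  case False
  then obtain x1 y1 x2 y2 where A: "A = ec_affine p x1 y1" "on_curve x1 y1"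
    and B: "B = ec_affine p x2 y2" "on_curve x2 y2"
    using assms by (metis E_cases)
  show ?thesis
  proof (cases "[x1 = x2] (mod p) \<and> [y1 = - y2] (mod p)")
    case True
    thus ?thesis using col_affine[OF A(2) B(2)] A B by simp
  next
    case False
    obtain l v x3 y3 where L: "line l v x1 y1 x2 y2 x3 y3"
      using line_exists[OF A(2) B(2) False] by blast
    have "C = ec_affine p x3 y3" if "C = ec_affine p x y" "line k w x1 y1 x2 y2 x y" for C k w x y
      using line_unique[OF L that(2)] that(1) by (simp add: ec_affine_eq_iff cong_sym)
    thus ?thesis using L False unfolding A B col_affine[OF A(2) B(2)] by metis
  qed
qed

definition third :: "ec_point \<Rightarrow> ec_point \<Rightarrow> ec_point" where
  "third A B = (THE C. col A B C)"

lemma col_third: "A \<in> E \<Longrightarrow> B \<in> E \<Longrightarrow> col A B (third A B)"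
  unfolding third_def by (rule theI') (rule ex1_col)

lemma third_eq: "col A B C \<Longrightarrow> third A B = C"
  unfolding third_def by (rule the1_equality[OF ex1_col]) (auto simp: col_def)

lemma third_Infinity: "A \<in> E \<Longrightarrow> third Infinity A = neg A"
  by (rule third_eq) (simp add: col_Infinity)

lemma finite_E: "finite E"
proof (rule finite_subset)
  show "E \<subseteq> insert Infinity (case_prod Affine ` (R \<times> R))"
    by (auto simp: E_def ec_affine_def)
qed simp

text \<open>Commutativity and cancellation hold because \<open>col\<close> is symmetric in its three
  arguments and any two of them determine the third.\<close>

lemma symmetric_quasigroup_third: "symmetric_quasigroup E Infinity third"
proof
  fix A B assume AB: "A \<in> E" "B \<in> E"
  show "third A B \<in> E" using col_third[OF AB] by (simp add: col_def)
  show "third A B = third B A" using col_third[OF AB] col_swap third_eq by metis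
  show "third A (third A B) = B" using col_third[OF AB] col_swap third_eq by metis
qed (simp_all add: finite_E Infinity_in_E third_Infinity)

end

text \<open>The chord from \<open>(x, y)\<close> to \<open>(- x, i y)\<close> has slope
  \<open>(1 - i) y / (2 x) = y / ((1 + i) x)\<close>, which is \<open>q\<close>. The modulus may be
  composite, so that the formula serves for \<open>N\<close> as well as for its prime
  divisors.\<close>

lemma ec_eta_affine_cases:
  fixes n m i c x y :: int
  assumes "odd n" "n > 1" "n dvd i\<^sup>2 + 1" "n dvd c * (1 + i) - 1"
  shows "coprime x n \<Longrightarrow> n dvd q * x - c * y \<Longrightarrow>
      ec_eta n m i (ec_affine n x y) = Some (ec_affine n (q\<^sup>2) (- q * (q\<^sup>2 + i * x)))"
    and "\<not> coprime x n \<Longrightarrow> ec_eta n m i (ec_affine n x y) \<in> {None, Some Infinity}"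
    and "n dvd x \<Longrightarrow> n dvd y \<Longrightarrow> ec_eta n m i (ec_affine n x y) = Some Infinity"
proof -
  define x1 y1 where "x1 = x mod n" and "y1 = y mod n"
  define x2 y2 where "x2 = (- x1) mod n" and "y2 = (i * y1) mod n"
  have eta: "ec_eta n m i (ec_affine n x y) = ec_add n m (Affine x1 y1) (Affine x2 y2)"
    by (simp add: ec_eta_def ec_affine_def x1_def y1_def x2_def y2_def)
  have "n dvd b mod n - b" for b by (metis dvd_diff_commute dvd_minus_mod)
  from this[of x] this[of y] this[of "- x1"] this[of "i * y1"]
  have d: "n dvd x1 - x" "n dvd y1 - y" "n dvd x2 + x1" "n dvd y2 - i * y1"
    by (simp_all flip: x1_def y1_def x2_def y2_def)
  have cop2: "coprime 2 n" using assms(1) by simp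
  have v: "[x2 - x1 = - 2 * x] (mod n)"
  proof -
    have "x2 - x1 - (- 2 * x) = (x2 + x1) + (- 2) * (x1 - x)" by simp
    moreover have "n dvd \<dots>" by (rule d | rule dvd_add | rule dvd_mult)+
    ultimately show ?thesis by (metis cong_iff_dvd_diff)
  qed
  have cop: "coprime (x2 - x1) n \<longleftrightarrow> coprime x n"
  proof -
    have "coprime (x2 - x1) n \<longleftrightarrow> coprime (- 2 * x) n"
      using v by (metis cong_imp_coprime cong_sym)
    thus ?thesis using cop2 by simp
  qed
  show "n dvd x \<Longrightarrow> n dvd y \<Longrightarrow> ec_eta n m i (ec_affine n x y) = Some Infinity"
    unfolding eta by (simp add: x1_def y1_def x2_def y2_def)
  show "ec_eta n m i (ec_affine n x y) \<in> {None, Some Infinity}" if "\<not> coprime x n"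
  proof -
    \<comment> \<open>The tangent branch yields no affine point: \<open>y1 = i y1\<close> gives
      \<open>2 y1 = 0\<close> modulo \<open>n\<close>, so its denominator is not invertible.\<close>
    have "\<not> coprime (2 * y1) n" if "[y1 = y2] (mod n)"
    proof
      assume "coprime (2 * y1) n"
      have "2 * y1 = (1 + i) * (y1 - y2) + (1 + i) * (y2 - i * y1) + y1 * (i\<^sup>2 + 1)"
        by (simp add: poly_simps)
      moreover have "n dvd \<dots>"
        by (rule d that[unfolded cong_iff_dvd_diff] assms(3) | rule dvd_add | rule dvd_mult)+
      ultimately have "n dvd 2 * y1" by metis
      hence "is_unit n" using \<open>coprime (2 * y1) n\<close> by (metis coprime_absorb_right)
      thus False using assms(2) by simp
    qed
    thus ?thesis using that cop unfolding eta by (auto simp: Let_def)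
  qed
  assume x: "coprime x n" and q: "n dvd q * x - c * y"
  have "\<not> [x1 = x2] (mod n)"
  proof
    assume "[x1 = x2] (mod n)"
    hence "n dvd x2 - x1" by (simp add: cong_iff_dvd_diff dvd_diff_commute)
    hence "is_unit n" using x cop by (metis coprime_absorb_right)
    thus False using assms(2) by simp
  qed
  moreover define l where "l = (y2 - y1) * modular_inverse n (x2 - x1)"
  ultimately have res: "ec_eta n m i (ec_affine n x y)
      = Some (ec_affine n (l\<^sup>2 - x1 - x2) (l * (x1 - (l\<^sup>2 - x1 - x2)) - y1))"
    using x cop unfolding eta by (simp add: Let_def)
  have inv: "n dvd (x2 - x1) * modular_inverse n (x2 - x1) - 1"
    using cong_modular_inverse1[of "x2 - x1" n] x cop by (simp add: cong_iff_dvd_diff)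
  have l1: "n dvd l * (- 2 * x) - (i - 1) * y"
  proof -
    have "l * (- 2 * x) - (i - 1) * y
      = (y2 - y1) * ((x2 - x1) * modular_inverse n (x2 - x1) - 1)
        + 2 * l * (x1 - x) - l * (x2 + x1) + (i - 1) * (y1 - y) + (y2 - i * y1)"
      by (simp add: l_def poly_simps)
    moreover have "n dvd \<dots>" by (rule d inv | rule dvd_add | rule dvd_diff | rule dvd_mult)+
    ultimately show ?thesis by metis
  qed
  \<comment> \<open>Multiplication by the unit \<open>2 * x\<close> compares the slope computed by
    \<open>ec_add\<close> with \<open>q\<close>.\<close>
  have "(2 * x) * (l - q) = (- 1) * (l * (- 2 * x) - (i - 1) * y) + (- 2) * (q * x - c * y)
      + ((i - 1) * y) * (c * (1 + i) - 1) + (- c * y) * (i\<^sup>2 + 1)"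
    by (simp add: poly_simps)
  moreover have "n dvd \<dots>" by (rule l1 q assms | rule dvd_add | rule dvd_mult)+
  ultimately have "n dvd (2 * x) * (l - q)" by metis
  moreover have "coprime n (2 * x)" using x cop2 by (simp add: coprime_commute)
  ultimately have lq: "n dvd l - q" by (simp only: coprime_dvd_mult_right_iff)
  have "y - (1 + i) * q * x = (- 1 - i) * (q * x - c * y) + (- y) * (c * (1 + i) - 1)"
    by (simp add: poly_simps)
  moreover have "n dvd \<dots>" by (rule q assms | rule dvd_add | rule dvd_mult)+
  ultimately have y: "n dvd y - (1 + i) * q * x" by metis
  have "(l\<^sup>2 - x1 - x2) - q\<^sup>2 = (l + q) * (l - q) - (x2 + x1)" by (simp add: poly_simps)
  moreover have "n dvd \<dots>" by (rule lq d | rule dvd_diff | rule dvd_mult)+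
  ultimately have X: "n dvd (l\<^sup>2 - x1 - x2) - q\<^sup>2" by metis
  have "(l * (x1 - (l\<^sup>2 - x1 - x2)) - y1) - (- q * (q\<^sup>2 + i * x))
      = (x1 - q\<^sup>2) * (l - q) + q * (x1 - x) - l * ((l\<^sup>2 - x1 - x2) - q\<^sup>2) - (y1 - y)
        - (y - (1 + i) * q * x)"
    by (simp add: poly_simps)
  moreover have "n dvd \<dots>" by (rule lq d X y | rule dvd_add | rule dvd_diff | rule dvd_mult)+
  ultimately have "n dvd (l * (x1 - (l\<^sup>2 - x1 - x2)) - y1) - (- q * (q\<^sup>2 + i * x))" by metis
  thus "ec_eta n m i (ec_affine n x y) = Some (ec_affine n (q\<^sup>2) (- q * (q\<^sup>2 + i * x)))"
    unfolding res using X by (simp add: ec_affine_eq_iff cong_iff_dvd_diff)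
qed

section \<open>The map \<open>\<eta>\<close> on the points modulo \<open>p\<close>, and its
  compatibility with collinearity\<close>

context eta_curve
begin

text \<open>Taking \<open>the\<close> is harmless on \<open>E\<close>, where the partial addition
  succeeds by \<open>ec_eta_eq\<close>.\<close>

definition \<eta> :: "ec_point \<Rightarrow> ec_point" where "\<eta> A = the (ec_eta p m i A)"

lemma coprime_p_iff: "coprime a p \<longleftrightarrow> \<not> p dvd a"
  using prime_p by (metis coprime_absorb_right coprime_commute not_prime_unit prime_imp_coprime)

lemma slope_exists:
  assumes "\<not> p dvd x"
  obtains q where "p dvd q * x - c * y" "p dvd y - (1 + i) * q * x"
proof -
  obtain n where n: "p dvd x * n - 1" using inverse_exists[OF assms] .
  define q where "q = c * y * n"
  have "q * x - c * y = c * y * (x * n - 1)" by (simp add: q_def poly_simps)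
  hence q: "p dvd q * x - c * y" using n by simp
  have "y - (1 + i) * q * x = (- 1 - i) * (q * x - c * y) + (- y) * (c * (1 + i) - 1)"
    by (simp add: poly_simps)
  moreover have "p dvd \<dots>" by (rule q c_inverse | rule dvd_add | rule dvd_mult)+
  ultimately show ?thesis using that q by metis
qed

lemma slope_unique:
  assumes "p dvd y - (1 + i) * q * x"
  shows "p dvd q * x - c * y"
proof -
  have "q * x - c * y = (- c) * (y - (1 + i) * q * x) + (- q * x) * (c * (1 + i) - 1)"
    by (simp add: poly_simps)
  moreover have "p dvd \<dots>" by (rule assms c_inverse | rule dvd_add | rule dvd_mult)+
  ultimately show ?thesis by metis
qed

text \<open>Squaring \<open>y = (1 + i) q x\<close> gives \<open>y^2 = 2 i q^2 x^2\<close>; a factor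
  \<open>x\<close> of the curve equation then cancels.\<close>

lemma curve_slope:
  assumes "on_curve x y" "\<not> p dvd x" "p dvd y - (1 + i) * q * x"
  shows "p dvd x\<^sup>2 - 2 * i * q\<^sup>2 * x - m"
proof -
  have "x * (x\<^sup>2 - 2 * i * q\<^sup>2 * x - m) = (- 1) * (y\<^sup>2 - (x ^ 3 - m * x))
    + (y + (1 + i) * q * x) * (y - (1 + i) * q * x) + q\<^sup>2 * x\<^sup>2 * (i\<^sup>2 + 1)"
    by (simp add: poly_simps)
  moreover have "p dvd \<dots>"
    by (rule assms[unfolded on_curve_def] i_square | rule dvd_add | rule dvd_mult)+
  ultimately show ?thesis using assms(2) by (metis dvd_mult_iff)
qed

lemma on_curve_zero: "on_curve x y \<Longrightarrow> p dvd x \<Longrightarrow> p dvd y"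
proof -
  assume a: "on_curve x y" "p dvd x"
  have "y\<^sup>2 = (y\<^sup>2 - (x ^ 3 - m * x)) + (x\<^sup>2 - m) * x" by (simp add: poly_simps)
  moreover have "p dvd \<dots>" by (rule a[unfolded on_curve_def] | rule dvd_add | rule dvd_mult)+
  ultimately have "p dvd y\<^sup>2" by metis
  thus ?thesis by (simp add: power2_eq_square dvd_mult_iff)
qed

lemma p_gt_1: "p > 1" using p_gt_2 by simp

lemma ec_eta_zero:
  assumes "on_curve x y" "p dvd x"
  shows "ec_eta p m i (ec_affine p x y) = Some Infinity"
  using ec_eta_affine_cases(3)[OF odd_p p_gt_1 i_square c_inverse assms(2) on_curve_zero[OF assms]] .

lemma ec_eta_nonzero:
  assumes "\<not> p dvd x" "p dvd y - (1 + i) * q * x"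
  shows "ec_eta p m i (ec_affine p x y) = Some (ec_affine p (q\<^sup>2) (- q * (q\<^sup>2 + i * x)))"
  using ec_eta_affine_cases(1)[OF odd_p p_gt_1 i_square c_inverse _ slope_unique[OF assms(2)]]
    assms(1) coprime_p_iff by blast

lemma ec_eta_eq: "A \<in> E \<Longrightarrow> ec_eta p m i A = Some (\<eta> A)"
proof (erule E_cases)
  fix x y assume "A = ec_affine p x y" "on_curve x y"
  thus "ec_eta p m i A = Some (\<eta> A)"
    using ec_eta_zero ec_eta_nonzero slope_exists unfolding \<eta>_def by (metis option.sel)
qed (simp add: \<eta>_def ec_eta_def)

lemma eta_Infinity [simp]: "\<eta> Infinity = Infinity"
  by (simp add: \<eta>_def ec_eta_def)

lemma eta_zero: "on_curve x y \<Longrightarrow> p dvd x \<Longrightarrow> \<eta> (ec_affine p x y) = Infinity"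
  by (simp add: \<eta>_def ec_eta_zero)

lemma eta_nonzero:
  "\<not> p dvd x \<Longrightarrow> p dvd y - (1 + i) * q * x \<Longrightarrow>
    \<eta> (ec_affine p x y) = ec_affine p (q\<^sup>2) (- q * (q\<^sup>2 + i * x))"
  by (simp add: \<eta>_def ec_eta_nonzero)

lemma eta_on_curve:
  assumes "p dvd x\<^sup>2 - 2 * i * q\<^sup>2 * x - m"
  shows "on_curve (q\<^sup>2) (- q * (q\<^sup>2 + i * x))"
proof -
  have "(- q * (q\<^sup>2 + i * x))\<^sup>2 - ((q\<^sup>2) ^ 3 - m * q\<^sup>2)
    = i\<^sup>2 * q\<^sup>2 * (x\<^sup>2 - 2 * i * q\<^sup>2 * x - m) + (2 * x * i * q ^ 4 + m * q\<^sup>2) * (i\<^sup>2 + 1)"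
    by (simp add: poly_simps eval_nat_numeral)
  moreover have "p dvd \<dots>" by (rule assms i_square | rule dvd_add | rule dvd_mult)+
  ultimately show ?thesis unfolding on_curve_def by metis
qed

lemma eta_in_E: "A \<in> E \<Longrightarrow> \<eta> A \<in> E"
proof (erule E_cases)
  fix x y assume A: "A = ec_affine p x y" "on_curve x y"
  show "\<eta> A \<in> E"
  proof (cases "p dvd x")
    case True
    thus ?thesis using A eta_zero Infinity_in_E by simp
  next
    case False
    then obtain q where q: "p dvd y - (1 + i) * q * x" using slope_exists by blast
    show ?thesis
      using eta_nonzero[OF False q] eta_on_curve[OF curve_slope[OF A(2) False q]] A(1)
      by (simp add: affine_in_E_iff)
  qed
qed (simp add: Infinity_in_E)

lemma eta_neg: "A \<in> E \<Longrightarrow> \<eta> (neg A) = neg (\<eta> A)"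
proof (erule E_cases)
  fix x y assume A: "A = ec_affine p x y" "on_curve x y"
  hence on: "on_curve x (- y)" by (simp add: on_curve_def)
  show "\<eta> (neg A) = neg (\<eta> A)"
  proof (cases "p dvd x")
    case True
    thus ?thesis using A on eta_zero by (simp add: neg_affine)
  next
    case False
    then obtain q where q: "p dvd y - (1 + i) * q * x" using slope_exists by blast
    hence "p dvd - (y - (1 + i) * q * x)" by (simp only: dvd_minus_iff)
    hence q': "p dvd - y - (1 + i) * (- q) * x" by simp
    show ?thesis
      using eta_nonzero[OF False q] eta_nonzero[OF False q'] A by (simp add: neg_affine)
  qed
qed simp

text \<open>
  With \<open>L = c l\<close>, \<open>V = c v\<close>, \<open>a = c\<^sup>2\<close> and \<open>n = 1 / V\<close>, the slopes \<open>q\<close> of the three points are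
  the numbers \<open>L + V / x\<close>, whose elementary symmetric functions are \<open>L - a m n\<close>, \<open>- 2 L a m n\<close>
  and \<open>a (V - L\<^sup>2 m n)\<close>. The image line has slope \<open>L + a m n\<close> and intercept \<open>a (V - L\<^sup>2 m n)\<close>.
\<close>

lemma line_image:
  assumes line: "line l v x1 y1 x2 y2 x3 y3"
    and x: "\<not> p dvd x1" "\<not> p dvd x2" "\<not> p dvd x3"
    and q1: "p dvd y1 - (1 + i) * q1 * x1" and q2: "p dvd y2 - (1 + i) * q2 * x2"
    and q3: "p dvd y3 - (1 + i) * q3 * x3"
  shows "\<exists>l' v'. line l' v' (q1\<^sup>2) (- q1 * (q1\<^sup>2 + i * x1)) (q2\<^sup>2) (- q2 * (q2\<^sup>2 + i * x2))
    (q3\<^sup>2) (- q3 * (q3\<^sup>2 + i * x3))"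
proof -
  define L V a where "L = c * l" and "V = c * v" and "a = c\<^sup>2"
  note a = c_facts[folded a_def]
  have V: "p dvd V - (q - L) * x" if "p dvd y - (l * x + v)" "p dvd y - (1 + i) * q * x" for x y q
  proof -
    have "V - (q - L) * x = (- c) * (y - (l * x + v)) - (q * x - c * y)"
      by (simp add: L_def V_def poly_simps)
    moreover have "p dvd \<dots>"
      by (rule that slope_unique[OF that(2)] | rule dvd_diff | rule dvd_mult)+
    ultimately show ?thesis by metis
  qed
  note V1 = V[OF lineD(1)[OF line] q1] and V2 = V[OF lineD(2)[OF line] q2]
    and V3 = V[OF lineD(3)[OF line] q3]
  have e1: "p dvd x1 + x2 + x3 - 2 * i * L\<^sup>2"
  proof -
    have "x1 + x2 + x3 - 2 * i * L\<^sup>2 = (x1 + x2 + x3 - l\<^sup>2) + (- l\<^sup>2) * (2 * i * a - 1)"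
      by (simp add: L_def a_def poly_simps)
    moreover have "p dvd \<dots>" by (rule lineD[OF line] a | rule dvd_add | rule dvd_mult)+
    ultimately show ?thesis by metis
  qed
  have e2: "p dvd x1 * x2 + x1 * x3 + x2 * x3 + m + 4 * i * L * V"
  proof -
    have "x1 * x2 + x1 * x3 + x2 * x3 + m + 4 * i * L * V
      = (x1 * x2 + x1 * x3 + x2 * x3 + m + 2 * l * v) + 2 * l * v * (2 * i * a - 1)"
      by (simp add: L_def V_def a_def poly_simps)
    moreover have "p dvd \<dots>" by (rule lineD[OF line] a | rule dvd_add | rule dvd_mult)+
    ultimately show ?thesis by metis
  qed
  have e3: "p dvd x1 * x2 * x3 - 2 * i * V\<^sup>2"
  proof -
    have "x1 * x2 * x3 - 2 * i * V\<^sup>2 = (x1 * x2 * x3 - v\<^sup>2) + (- v\<^sup>2) * (2 * i * a - 1)"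
      by (simp add: V_def a_def poly_simps)
    moreover have "p dvd \<dots>" by (rule lineD[OF line] a | rule dvd_add | rule dvd_mult)+
    ultimately show ?thesis by metis
  qed
  have not_V: "\<not> p dvd V"
  proof
    assume "p dvd V"
    hence "p dvd (x1 * x2 * x3 - 2 * i * V\<^sup>2) + 2 * i * V * V"
      using e3 by (intro dvd_add dvd_mult)
    hence "p dvd x1 * x2 * x3" by (simp add: power2_eq_square)
    thus False using x by (simp add: dvd_mult_iff)
  qed
  obtain n where n: "p dvd V * n - 1" using inverse_exists[OF not_V] .
  obtain u1 where u1: "p dvd x1 * u1 - 1" using inverse_exists[OF x(1)] .
  obtain u2 where u2: "p dvd x2 * u2 - 1" using inverse_exists[OF x(2)] .
  obtain u3 where u3: "p dvd x3 * u3 - 1" using inverse_exists[OF x(3)] .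
  \<comment> \<open>\<open>U3\<close>, \<open>U1\<close> and \<open>U2\<close> are the elementary
    symmetric functions of the inverses \<open>u1, u2, u3\<close>. They arise from \<open>e1\<close>
    and \<open>e2\<close> on division by \<open>x1 * x2 * x3 = 2 i V^2\<close>, where
    \<open>a * n^2\<close> is the inverse of \<open>2 i V^2\<close>.\<close>
  have U3: "p dvd u1 * u2 * u3 - a * n\<^sup>2"
  proof -
    have "u1 * u2 * u3 - a * n\<^sup>2 = (- a * n\<^sup>2 * u1 * u2 * u3) * (x1 * x2 * x3 - 2 * i * V\<^sup>2)
      + a * n\<^sup>2 * (x1 * u1 - 1) + a * n\<^sup>2 * u1 * x1 * (x2 * u2 - 1)
      + a * n\<^sup>2 * u1 * u2 * x1 * x2 * (x3 * u3 - 1)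
      + (- V * n * u1 * u2 * u3 - u1 * u2 * u3) * (V * n - 1)
      + (- V\<^sup>2 * n\<^sup>2 * u1 * u2 * u3) * (2 * i * a - 1)"
      by (simp add: poly_simps)
    moreover have "p dvd \<dots>" by (rule e3 u1 u2 u3 n a | rule dvd_add | rule dvd_mult)+
    ultimately show ?thesis by metis
  qed
  have U1: "p dvd u1 + u2 + u3 + a * n\<^sup>2 * (m + 4 * i * L * V)"
  proof -
    have "u1 + u2 + u3 + a * n\<^sup>2 * (m + 4 * i * L * V)
      = (x2 * x3 + x1 * x3 + x1 * x2) * (u1 * u2 * u3 - a * n\<^sup>2)
      + (- u3 - u2) * (x1 * u1 - 1) + (- u1 * u3 * x1 - u1) * (x2 * u2 - 1)
      + (- u1 * u2 * x2 - u1 * u2 * x1) * (x3 * u3 - 1)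
      + a * n\<^sup>2 * (x1 * x2 + x1 * x3 + x2 * x3 + m + 4 * i * L * V)"
      by (simp add: poly_simps)
    moreover have "p dvd \<dots>" by (rule e2 U3 u1 u2 u3 | rule dvd_add | rule dvd_mult)+
    ultimately show ?thesis by metis
  qed
  have U2: "p dvd u1 * u2 + u1 * u3 + u2 * u3 - L\<^sup>2 * n\<^sup>2"
  proof -
    have "u1 * u2 + u1 * u3 + u2 * u3 - L\<^sup>2 * n\<^sup>2
      = (x3 + x2 + x1) * (u1 * u2 * u3 - a * n\<^sup>2)
      + (- u2 * u3) * (x1 * u1 - 1) + (- u1 * u3) * (x2 * u2 - 1) + (- u1 * u2) * (x3 * u3 - 1)
      + a * n\<^sup>2 * (x1 + x2 + x3 - 2 * i * L\<^sup>2) + L\<^sup>2 * n\<^sup>2 * (2 * i * a - 1)"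
      by (simp add: poly_simps)
    moreover have "p dvd \<dots>" by (rule e1 U3 u1 u2 u3 a | rule dvd_add | rule dvd_mult)+
    ultimately show ?thesis by metis
  qed
  have Q: "p dvd q - (L + V * u)" if "p dvd V - (q - L) * x" "p dvd x * u - 1" for q x u
  proof -
    have "q - (L + V * u) = (- u) * (V - (q - L) * x) + (L - q) * (x * u - 1)"
      by (simp add: poly_simps)
    moreover have "p dvd \<dots>" by (rule that | rule dvd_add | rule dvd_mult)+
    ultimately show ?thesis by metis
  qed
  note Q1 = Q[OF V1 u1] and Q2 = Q[OF V2 u2] and Q3 = Q[OF V3 u3]
  define M N where "M = L + a * m * n" and "N = a * (V - L\<^sup>2 * m * n)"
  have F1: "p dvd q1 + q2 + q3 - (L - a * m * n)"
  proof -
    have "q1 + q2 + q3 - (L - a * m * n)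
      = (q1 - (L + V * u1)) + (q2 - (L + V * u2)) + (q3 - (L + V * u3))
      + V * (u1 + u2 + u3 + a * n\<^sup>2 * (m + 4 * i * L * V))
      + (- 4 * L * V * a * i * n - a * m * n - 2 * L) * (V * n - 1)
      + (- 2 * L * V * n) * (2 * i * a - 1)"
      by (simp add: poly_simps)
    moreover have "p dvd \<dots>" by (rule Q1 Q2 Q3 U1 n a | rule dvd_add | rule dvd_mult)+
    ultimately show ?thesis by metis
  qed
  have F2: "p dvd q1 * q2 + q1 * q3 + q2 * q3 + 2 * L * a * m * n"
  proof -
    have "q1 * q2 + q1 * q3 + q2 * q3 + 2 * L * a * m * n
      = (q2 + q3) * (q1 - (L + V * u1)) + (L + V * u1 + q3) * (q2 - (L + V * u2))
      + (L + V * u1 + (L + V * u2)) * (q3 - (L + V * u3))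
      + 2 * L * V * (u1 + u2 + u3 + a * n\<^sup>2 * (m + 4 * i * L * V))
      + V\<^sup>2 * (u1 * u2 + u1 * u3 + u2 * u3 - L\<^sup>2 * n\<^sup>2)
      + (- 8 * L\<^sup>2 * V * a * i * n - 2 * L * a * m * n + L\<^sup>2 * V * n - 3 * L\<^sup>2) * (V * n - 1)
      + (- 4 * L\<^sup>2 * V * n) * (2 * i * a - 1)"
      by (simp add: poly_simps)
    moreover have "p dvd \<dots>" by (rule Q1 Q2 Q3 U1 U2 n a | rule dvd_add | rule dvd_mult)+
    ultimately show ?thesis by metis
  qed
  have F3: "p dvd q1 * q2 * q3 - N"
  proof -
    have "q1 * q2 * q3 - N
      = q2 * q3 * (q1 - (L + V * u1)) + (L + V * u1) * q3 * (q2 - (L + V * u2))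
      + (L + V * u1) * (L + V * u2) * (q3 - (L + V * u3))
      + L\<^sup>2 * V * (u1 + u2 + u3 + a * n\<^sup>2 * (m + 4 * i * L * V))
      + L * V\<^sup>2 * (u1 * u2 + u1 * u3 + u2 * u3 - L\<^sup>2 * n\<^sup>2)
      + V ^ 3 * (u1 * u2 * u3 - a * n\<^sup>2)
      + (- 4 * L ^ 3 * V * a * i * n - L\<^sup>2 * a * m * n + L ^ 3 * V * n + V\<^sup>2 * a * n - L ^ 3 + V * a)
        * (V * n - 1)
      + (- 2 * L ^ 3 * V * n) * (2 * i * a - 1)"
      by (simp add: poly_simps N_def)
    moreover have "p dvd \<dots>" by (rule Q1 Q2 Q3 U1 U2 U3 n a | rule dvd_add | rule dvd_mult)+
    ultimately show ?thesis by metis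
  qed
  have Y: "p dvd - q * (q\<^sup>2 + i * x) - (M * q\<^sup>2 + N)"
    if "p dvd V - (q - L) * x" "p dvd x\<^sup>2 - 2 * i * q\<^sup>2 * x - m" for q x
  proof -
    \<comment> \<open>The factor \<open>V\<close> is a unit; it clears the inverse \<open>n\<close>
      contained in \<open>M\<close> and \<open>N\<close>.\<close>
    have "V * (- q * (q\<^sup>2 + i * x) - (M * q\<^sup>2 + N))
      = (- 1) * ((2 * a * i * q ^ 3 + 2 * L * a * i * q\<^sup>2 - 2 * L\<^sup>2 * a * i * q
        - 2 * L ^ 3 * a * i - a * q * x - L * a * x + L\<^sup>2 * q + L ^ 3 - V * i - V * a)
          * (V - (q - L) * x)
      + (- a * q\<^sup>2 + L\<^sup>2 * a) * (x\<^sup>2 - 2 * i * q\<^sup>2 * x - m)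
      + (- L\<^sup>2 * q\<^sup>2 * x + L ^ 4 * x - V * q ^ 3 - L * V * q\<^sup>2 + L\<^sup>2 * V * q + L ^ 3 * V)
          * (2 * i * a - 1)
      + (L * V * x + V\<^sup>2) * (2 * a + i) + (a * m * q\<^sup>2 - a * m * L\<^sup>2) * (V * n - 1))"
      by (simp add: poly_simps M_def N_def eval_nat_numeral)
    moreover have "p dvd \<dots>" by (rule that a n | rule dvd_add | rule dvd_mult)+
    ultimately show ?thesis using not_V by (metis dvd_mult_iff)
  qed
  have "line M N (q1\<^sup>2) (- q1 * (q1\<^sup>2 + i * x1)) (q2\<^sup>2) (- q2 * (q2\<^sup>2 + i * x2))
    (q3\<^sup>2) (- q3 * (q3\<^sup>2 + i * x3))"
    unfolding line_def
  proof (intro conjI)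
    show "p dvd - q1 * (q1\<^sup>2 + i * x1) - (M * q1\<^sup>2 + N)"
      by (rule Y[OF V1 curve_slope[OF line_on_curve(1)[OF line] x(1) q1]])
    show "p dvd - q2 * (q2\<^sup>2 + i * x2) - (M * q2\<^sup>2 + N)"
      by (rule Y[OF V2 curve_slope[OF line_on_curve(2)[OF line] x(2) q2]])
    show "p dvd - q3 * (q3\<^sup>2 + i * x3) - (M * q3\<^sup>2 + N)"
      by (rule Y[OF V3 curve_slope[OF line_on_curve(3)[OF line] x(3) q3]])
    \<comment> \<open>The three remaining conditions express the elementary symmetric functions of
      the squares of the slopes through those of the slopes in \<open>F1\<close>, \<open>F2\<close>,
      \<open>F3\<close>; the middle one also needs \<open>4 a^2 = - 1\<close>.\<close>
    have "q1\<^sup>2 + q2\<^sup>2 + q3\<^sup>2 - M\<^sup>2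
      = (q1 + q2 + q3 + (L - a * m * n)) * (q1 + q2 + q3 - (L - a * m * n))
        + (- 2) * (q1 * q2 + q1 * q3 + q2 * q3 + 2 * L * a * m * n)"
      by (simp add: poly_simps M_def)
    moreover have "p dvd \<dots>" by (rule F1 F2 | rule dvd_add | rule dvd_mult)+
    ultimately show "p dvd q1\<^sup>2 + q2\<^sup>2 + q3\<^sup>2 - M\<^sup>2" by metis
    have "q1\<^sup>2 * q2\<^sup>2 + q1\<^sup>2 * q3\<^sup>2 + q2\<^sup>2 * q3\<^sup>2 + m + 2 * M * N
      = (q1 * q2 + q1 * q3 + q2 * q3 - 2 * L * a * m * n)
          * (q1 * q2 + q1 * q3 + q2 * q3 + 2 * L * a * m * n)
        + (- 2 * q1 * q2 * q3) * (q1 + q2 + q3 - (L - a * m * n))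
        + (- 2 * (L - a * m * n)) * (q1 * q2 * q3 - N)
        + m * (4 * a\<^sup>2 + 1) + 4 * a\<^sup>2 * m * (V * n - 1)"
      by (simp add: poly_simps M_def N_def)
    moreover have "p dvd \<dots>" by (rule F1 F2 F3 a n | rule dvd_add | rule dvd_mult)+
    ultimately show "p dvd q1\<^sup>2 * q2\<^sup>2 + q1\<^sup>2 * q3\<^sup>2 + q2\<^sup>2 * q3\<^sup>2 + m + 2 * M * N" by metis
    have "q1\<^sup>2 * q2\<^sup>2 * q3\<^sup>2 - N\<^sup>2 = (q1 * q2 * q3 + N) * (q1 * q2 * q3 - N)"
      by (simp add: poly_simps)
    moreover have "p dvd \<dots>" by (rule F3 | rule dvd_mult)+
    ultimately show "p dvd q1\<^sup>2 * q2\<^sup>2 * q3\<^sup>2 - N\<^sup>2" by metis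
  qed
  thus ?thesis by blast
qed

text \<open>A line through \<open>(0, 0)\<close> has \<open>v = 0\<close>, so the other two points
  have the same \<open>q = L\<close>. Their images share the abscissa \<open>q^2\<close> and have
  opposite ordinates, while \<open>(0, 0)\<close> goes to \<open>Infinity\<close>.\<close>

lemma col_eta_of_zero:
  assumes line: "line l v x1 y1 x2 y2 x3 y3" and x1: "p dvd x1"
  shows "col (\<eta> (ec_affine p x1 y1)) (\<eta> (ec_affine p x2 y2)) (\<eta> (ec_affine p x3 y3))"
proof -
  note on = line_on_curve[OF line]
  have y1: "p dvd y1" using on_curve_zero on(1) x1 .
  have "v = y1 - (y1 - (l * x1 + v)) - l * x1" by simp
  moreover have "p dvd \<dots>" by (rule lineD[OF line] y1 x1 | rule dvd_diff | rule dvd_mult)+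
  ultimately have v: "p dvd v" by metis
  have "x2 * x3 + m = (x1 * x2 + x1 * x3 + x2 * x3 + m + 2 * l * v) - (x2 + x3) * x1 - 2 * l * v"
    by (simp add: poly_simps)
  moreover have "p dvd \<dots>" by (rule lineD[OF line] v x1 | rule dvd_diff | rule dvd_mult)+
  ultimately have e2: "p dvd x2 * x3 + m" by metis
  hence x: "\<not> p dvd x2" "\<not> p dvd x3"
    using m_unit by (metis dvd_add_right_iff dvd_mult2 dvd_mult)+
  obtain q2 where q2: "p dvd y2 - (1 + i) * q2 * x2" using slope_exists[OF x(1)] by blast
  obtain q3 where q3: "p dvd y3 - (1 + i) * q3 * x3" using slope_exists[OF x(2)] by blast
  define L where "L = c * l"
  have Q: "p dvd q - L"
    if "p dvd y - (l * x + v)" "p dvd y - (1 + i) * q * x" "\<not> p dvd x" for x y q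
  proof -
    have "x * (q - L) = c * (y - (l * x + v)) + (q * x - c * y) + c * v"
      by (simp add: L_def poly_simps)
    moreover have "p dvd \<dots>"
      by (rule that(1) slope_unique[OF that(2)] v | rule dvd_add | rule dvd_mult)+
    ultimately show ?thesis using that(3) by (metis dvd_mult_iff)
  qed
  note Q2 = Q[OF lineD(2)[OF line] q2 x(1)] and Q3 = Q[OF lineD(3)[OF line] q3 x(2)]
  have "q2\<^sup>2 - q3\<^sup>2 = (q2 + q3) * (q2 - L) - (q2 + q3) * (q3 - L)" by (simp add: poly_simps)
  moreover have "p dvd \<dots>" by (rule Q2 Q3 | rule dvd_diff | rule dvd_mult)+
  ultimately have X: "[q3\<^sup>2 = q2\<^sup>2] (mod p)"
    by (metis cong_iff_dvd_diff cong_sym)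
  have e1: "p dvd x2 + x3 - 2 * i * L\<^sup>2"
  proof -
    have "x2 + x3 - 2 * i * L\<^sup>2 = (x1 + x2 + x3 - l\<^sup>2) + (- l\<^sup>2) * (2 * i * c\<^sup>2 - 1) - x1"
      by (simp add: L_def poly_simps)
    moreover have "p dvd \<dots>"
      by (rule lineD[OF line] c_facts x1 | rule dvd_diff | rule dvd_add | rule dvd_mult)+
    ultimately show ?thesis by metis
  qed
  have "- q3 * (q3\<^sup>2 + i * x3) - (- (- q2 * (q2\<^sup>2 + i * x2)))
    = (- (q3\<^sup>2 + q3 * L + L\<^sup>2) - i * x3) * (q3 - L) + (- (q2\<^sup>2 + q2 * L + L\<^sup>2) - i * x2) * (q2 - L)
      + (- L * i) * (x2 + x3 - 2 * i * L\<^sup>2) + (- 2 * L ^ 3) * (i\<^sup>2 + 1)"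
    by (simp add: poly_simps)
  moreover have "p dvd \<dots>" by (rule Q2 Q3 e1 i_square | rule dvd_add | rule dvd_mult)+
  ultimately have "p dvd - q3 * (q3\<^sup>2 + i * x3) - (- (- q2 * (q2\<^sup>2 + i * x2)))" by metis
  hence Y: "[- q3 * (q3\<^sup>2 + i * x3) = - (- q2 * (q2\<^sup>2 + i * x2))] (mod p)"
    by (simp only: cong_iff_dvd_diff)
  have "\<eta> (ec_affine p x3 y3) = neg (\<eta> (ec_affine p x2 y2))"
    unfolding eta_nonzero[OF x(1) q2] eta_nonzero[OF x(2) q3] neg_affine ec_affine_eq_iff
    using X Y by blast
  thus ?thesis
    using eta_zero[OF on(1) x1] eta_in_E on affine_in_E_iff by (simp add: col_Infinity)
qed

lemma col_eta:
  assumes "col A B C"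
  shows "col (\<eta> A) (\<eta> B) (\<eta> C)"
proof (cases "A = Infinity \<or> B = Infinity \<or> C = Infinity")
  case True
  have *: "col (\<eta> Infinity) (\<eta> B) (\<eta> C)" if "col Infinity B C" for B C
    using that eta_in_E eta_neg by (simp add: col_Infinity)
  show ?thesis using True
  proof (elim disjE)
    assume "B = Infinity"
    thus ?thesis using *[of A C] col_swap assms by blast
  next
    assume C: "C = Infinity"
    have "col C A B" using assms col_swap by blast
    hence "col (\<eta> C) (\<eta> A) (\<eta> B)" using * C by blast
    thus ?thesis using col_swap by blast
  qed (use * assms in blast)
next
  case False
  obtain x1 y1 x2 y2 x3 y3 l v where A: "A = ec_affine p x1 y1" and B: "B = ec_affine p x2 y2"
    and C: "C = ec_affine p x3 y3" and L: "line l v x1 y1 x2 y2 x3 y3"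
    using assms False unfolding col_def by blast
  show ?thesis
  proof (cases "p dvd x1 \<or> p dvd x2 \<or> p dvd x3")
    case True
    have "line l v x3 y3 x1 y1 x2 y2" using line_swap L by blast
    hence "col (\<eta> C) (\<eta> A) (\<eta> B)" if "p dvd x3"
      using col_eta_of_zero that unfolding A B C by blast
    moreover have "col (\<eta> B) (\<eta> A) (\<eta> C)" if "p dvd x2"
      using col_eta_of_zero that line_swap(1)[OF L] unfolding A B C by blast
    moreover have "col (\<eta> A) (\<eta> B) (\<eta> C)" if "p dvd x1"
      using col_eta_of_zero that L unfolding A B C by blast
    ultimately show ?thesis using True col_swap by blast
  next
    case False
    hence x: "\<not> p dvd x1" "\<not> p dvd x2" "\<not> p dvd x3" by auto
    obtain q1 where q1: "p dvd y1 - (1 + i) * q1 * x1" using slope_exists[OF x(1)] by blast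
    obtain q2 where q2: "p dvd y2 - (1 + i) * q2 * x2" using slope_exists[OF x(2)] by blast
    obtain q3 where q3: "p dvd y3 - (1 + i) * q3 * x3" using slope_exists[OF x(3)] by blast
    have "\<eta> A \<in> E" "\<eta> B \<in> E" "\<eta> C \<in> E" using assms eta_in_E by (auto simp: col_def)
    thus ?thesis
      using line_image[OF L x q1 q2 q3]
      unfolding col_def A B C eta_nonzero[OF x(1) q1] eta_nonzero[OF x(2) q2]
        eta_nonzero[OF x(3) q3] by blast
  qed
qed

lemma eta_third: "A \<in> E \<Longrightarrow> B \<in> E \<Longrightarrow> \<eta> (third A B) = third (\<eta> A) (\<eta> B)"
  using third_eq[OF col_eta[OF col_third]] by simp

section \<open>The kernel of \<open>\<eta>\<close>, the 2-torsion and the number of points\<close>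

definition z :: ec_point where "z = ec_affine p 0 0"

lemma z_in_E: "z \<in> E" by (simp add: z_def affine_in_E_iff on_curve_def)

lemma z_neq_Infinity: "z \<noteq> Infinity" by (simp add: z_def)

lemma eta_eq_Infinity_iff:
  assumes "A \<in> E"
  shows "\<eta> A = Infinity \<longleftrightarrow> A = Infinity \<or> A = z"
  using assms
proof (cases rule: E_cases)
  case (2 x y)
  show ?thesis
  proof (cases "p dvd x")
    case True
    thus ?thesis using 2 on_curve_zero eta_zero by (simp add: z_def ec_affine_eq_iff cong_0_iff)
  next
    case False
    then obtain q where q: "p dvd y - (1 + i) * q * x" using slope_exists by blast
    show ?thesis
      unfolding 2(1) eta_nonzero[OF False q] using False
      by (simp add: z_def ec_affine_eq_iff cong_0_iff)
  qed
qed simp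

sublocale symmetric_quasigroup_endo E Infinity third \<eta> z
  by (intro symmetric_quasigroup_endo.intro symmetric_quasigroup_third
      symmetric_quasigroup_endo_axioms.intro)
     (simp_all add: eta_in_E eta_third z_in_E z_neq_Infinity eta_eq_Infinity_iff)

lemma s_unit: "\<not> p dvd s"
proof
  assume "p dvd s"
  hence "p dvd s * s - (s\<^sup>2 - m)" using s_square by (metis dvd_diff dvd_mult)
  thus False using m_unit by (simp add: power2_eq_square)
qed

lemma eta_s: "\<eta> (ec_affine p s 0) = z" "\<eta> (ec_affine p (- s) 0) = z"
  using eta_nonzero[of s 0 0] eta_nonzero[of "- s" 0 0] s_unit by (simp_all add: z_def)

lemma square_eq_m:
  assumes "p dvd x\<^sup>2 - m"
  shows "[x = s] (mod p) \<or> [x = - s] (mod p)"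
proof -
  have "(x - s) * (x - - s) = (x\<^sup>2 - m) - (s\<^sup>2 - m)" by (simp add: poly_simps)
  moreover have "p dvd \<dots>" using assms s_square by (rule dvd_diff)
  ultimately show ?thesis by (metis dvd_mult_iff cong_iff_dvd_diff)
qed

text \<open>The image has abscissa \<open>q^2\<close>, so \<open>q = 0\<close>. Then
  \<open>y = 0\<close>, and \<open>curve_slope\<close> leaves \<open>x^2 = m\<close>.\<close>

lemma eta_eq_z_imp:
  assumes "A \<in> E" "\<eta> A = z"
  shows "A = ec_affine p s 0 \<or> A = ec_affine p (- s) 0"
  using assms(1)
proof (cases rule: E_cases)
  case 1
  thus ?thesis using assms(2) by (simp add: z_def)
next
  case (2 x y)
  have x: "\<not> p dvd x"
    using eta_zero[OF 2(2)] assms(2) 2(1) by (auto simp: z_def)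
  then obtain q where q: "p dvd y - (1 + i) * q * x" using slope_exists by blast
  have "p dvd q\<^sup>2"
    using assms(2) unfolding 2(1) eta_nonzero[OF x q] z_def by (simp add: ec_affine_eq_iff cong_0_iff)
  hence pq: "p dvd q" by (simp add: power2_eq_square dvd_mult_iff)
  have "y = (y - (1 + i) * q * x) + (1 + i) * x * q" by (simp add: poly_simps)
  moreover have "p dvd \<dots>" by (rule q pq | rule dvd_add | rule dvd_mult)+
  ultimately have y: "p dvd y" by metis
  have "x\<^sup>2 - m = (x\<^sup>2 - 2 * i * q\<^sup>2 * x - m) + 2 * i * q * x * q" by (simp add: poly_simps)
  moreover have "p dvd \<dots>" by (rule curve_slope[OF 2(2) x q] pq | rule dvd_add | rule dvd_mult)+
  ultimately have "p dvd x\<^sup>2 - m" by metis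
  thus ?thesis using square_eq_m y unfolding 2(1) ec_affine_eq_iff cong_0_iff by blast
qed

text \<open>The abscissa of an image point is \<open>q^2\<close>. This keeps a point with
  non-residue \<open>x\<close> outside the image of \<open>\<eta>\<close>.\<close>

lemma eta_QuadRes:
  assumes "A \<in> E" "\<eta> A = ec_affine p x y"
  shows "QuadRes p x"
  using assms(1)
proof (cases rule: E_cases)
  case 1
  thus ?thesis using assms(2) by simp
next
  case (2 x' y')
  have x: "\<not> p dvd x'" using eta_zero[OF 2(2)] assms(2) 2(1) by auto
  then obtain q where q: "p dvd y' - (1 + i) * q * x'" using slope_exists by blast
  have "[q\<^sup>2 = x] (mod p)"
    using assms(2) unfolding 2(1) eta_nonzero[OF x q] by (simp add: ec_affine_eq_iff)
  thus ?thesis unfolding QuadRes_def by blast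
qed

text \<open>The points fixed by negation are those of \<open>E[2]\<close>, and two applications of
  \<open>\<eta>\<close> send them to \<open>Infinity\<close>.\<close>

lemma nilpotent_of_neg_fixed:
  assumes "A \<in> E" "third Infinity A = A"
  shows "\<exists>j. (\<eta> ^^ j) A = Infinity"
  using assms(1)
proof (cases rule: E_cases)
  case 1
  thus ?thesis by (intro exI[of _ 0]) simp
next
  case (2 x y)
  have "[- y = y] (mod p)"
    using assms third_Infinity unfolding 2(1) by (simp add: neg_affine ec_affine_eq_iff)
  hence "p dvd (y - - y)" by (metis cong_iff_dvd_diff cong_sym)
  hence "p dvd 2 * y" by simp
  hence y: "p dvd y" using not_dvd_2 by (metis dvd_mult_iff)
  have "x * (x\<^sup>2 - m) = y * y - (y\<^sup>2 - (x ^ 3 - m * x))" by (simp add: poly_simps)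
  moreover have "p dvd \<dots>" by (rule y 2(2)[unfolded on_curve_def] | rule dvd_diff | rule dvd_mult)+
  ultimately have "p dvd x \<or> p dvd x\<^sup>2 - m" by (metis dvd_mult_iff)
  thus ?thesis
  proof
    assume "p dvd x"
    thus ?thesis using eta_zero[OF 2(2)] 2(1) by (intro exI[of _ 1]) simp
  next
    assume "p dvd x\<^sup>2 - m"
    hence "A = ec_affine p s 0 \<or> A = ec_affine p (- s) 0"
      using square_eq_m y unfolding 2(1) ec_affine_eq_iff cong_0_iff by blast
    hence "\<eta> A = z" using eta_s by blast
    thus ?thesis using eta_eq_Infinity_iff z_in_E by (intro exI[of _ 2]) (simp add: eval_nat_numeral)
  qed
qed

lemma card_E: "int (card E) = p + 1 + (\<Sum>x\<in>R. \<chi> (x * (x\<^sup>2 - m)))"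
proof -
  define S where "S = Sigma R (\<lambda>x. {y \<in> R. [y\<^sup>2 = x * (x\<^sup>2 - m)] (mod p)})"
  have on: "on_curve x y \<longleftrightarrow> [y\<^sup>2 = x * (x\<^sup>2 - m)] (mod p)" for x y
    unfolding on_curve_def cong_iff_dvd_diff by (simp add: poly_simps)
  have E_eq: "E = insert Infinity (case_prod Affine ` S)"
  proof (intro equalityI subsetI)
    fix A assume "A \<in> E"
    thus "A \<in> insert Infinity (case_prod Affine ` S)"
    proof (cases rule: E_cases)
      case (2 x y)
      have "on_curve (x mod p) (y mod p)" using 2(2) on_curve_cong[of "x mod p" x "y mod p" y] by simp
      thus ?thesis using 2(1) on by (auto simp: S_def ec_affine_def)
    qed simp
  next
    fix A assume "A \<in> insert Infinity (case_prod Affine ` S)"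
    moreover have "Affine x y = ec_affine p x y" if "(x, y) \<in> S" for x y
      using that by (simp add: S_def R_def ec_affine_def)
    ultimately show "A \<in> E" using on by (auto simp: Infinity_in_E affine_in_E_iff S_def)
  qed
  have "finite S" unfolding S_def by auto
  moreover have "Infinity \<notin> case_prod Affine ` S" by auto
  moreover have "inj_on (case_prod Affine) S" by (auto simp: inj_on_def)
  ultimately have "card E = 1 + card S"
    unfolding E_eq by (subst card_insert_disjoint, blast, blast, subst card_image) simp_all
  also have "int \<dots> = 1 + (\<Sum>x\<in>R. int (card {y \<in> R. [y\<^sup>2 = x * (x\<^sup>2 - m)] (mod p)}))"
    by (simp add: S_def)
  also have "\<dots> = p + 1 + (\<Sum>x\<in>R. \<chi> (x * (x\<^sup>2 - m)))"
    using card_R by (simp add: card_square_roots sum.distrib)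
  finally show ?thesis .
qed

lemma card_E_le: "int (card E) \<le> 2 * p + 1"
proof -
  have "(\<Sum>x\<in>R. \<chi> (x * (x\<^sup>2 - m))) \<le> (\<Sum>x\<in>R. 1)"
    by (intro sum_mono) (simp add: Legendre_def)
  thus ?thesis using card_R card_E by simp
qed

text \<open>As \<open>m\<close> is a fourth power, \<open>(s, 0)\<close> has a preimage under
  \<open>\<eta>\<close>, hence \<open>z\<close> is in the image of
  \<open>\<eta> ^^ 2\<close>.\<close>

lemma eight_dvd_card_E:
  assumes "[t ^ 4 = m] (mod p)"
  shows "8 dvd card E"
proof -
  obtain r where r: "p dvd r\<^sup>2 - s"
  proof -
    \<comment> \<open>\<open>s\<close> is \<open>t^2\<close> or \<open>- t^2\<close>, and the latter
      is the square of \<open>i * t\<close>.\<close>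
    have "(t\<^sup>2 - s) * ((i * t)\<^sup>2 - s) = (- 1) * (t ^ 4 - m) + (s\<^sup>2 - m) + t\<^sup>2 * (t\<^sup>2 - s) * (i\<^sup>2 + 1)"
      by (simp add: poly_simps eval_nat_numeral)
    moreover have "p dvd \<dots>"
      by (rule assms[unfolded cong_iff_dvd_diff] s_square i_square | rule dvd_add | rule dvd_mult)+
    ultimately show ?thesis using that by (metis dvd_mult_iff)
  qed
  \<comment> \<open>The preimage has to satisfy \<open>q^2 = s\<close> and
    \<open>q^2 + i x = 0\<close>; with \<open>q = - r\<close> this gives \<open>x = i s\<close> and
    \<open>y = (1 + i) q x\<close>.\<close>
  define x y where "x = i * s" and "y = (1 - i) * s * r"
  have "y\<^sup>2 - (x ^ 3 - m * x) = (1 - i)\<^sup>2 * s\<^sup>2 * (r\<^sup>2 - s) + (- i * s) * (s\<^sup>2 - m)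
    + (s ^ 3 - i * s ^ 3) * (i\<^sup>2 + 1)"
    by (simp add: x_def y_def poly_simps)
  moreover have "p dvd \<dots>" by (rule r s_square i_square | rule dvd_add | rule dvd_mult)+
  ultimately have on: "on_curve x y" unfolding on_curve_def by metis
  have "\<not> p dvd i"
  proof
    assume "p dvd i"
    hence "p dvd (i\<^sup>2 + 1) - i * i" using i_square by (metis dvd_diff dvd_mult)
    thus False using p_gt_1 by (simp add: power2_eq_square)
  qed
  hence x: "\<not> p dvd x" using s_unit by (simp add: x_def dvd_mult_iff)
  have "y - (1 + i) * (- r) * x = (s * r) * (i\<^sup>2 + 1)" by (simp add: x_def y_def poly_simps)
  hence q: "p dvd y - (1 + i) * (- r) * x" using i_square by simp
  have "- (- r) * ((- r)\<^sup>2 + i * x) - 0 = r * (r\<^sup>2 - s) + r * s * (i\<^sup>2 + 1)"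
    by (simp add: x_def poly_simps)
  moreover have "p dvd \<dots>" by (rule r i_square | rule dvd_add | rule dvd_mult)+
  ultimately have "p dvd - (- r) * ((- r)\<^sup>2 + i * x) - 0" by metis
  hence "\<eta> (ec_affine p x y) = ec_affine p s 0"
    unfolding eta_nonzero[OF x q] ec_affine_eq_iff cong_iff_dvd_diff using r by simp
  hence "(\<eta> ^^ 2) (ec_affine p x y) = z" using eta_s by (simp add: eval_nat_numeral)
  moreover have "ec_affine p x y \<in> E" using on by (simp add: affine_in_E_iff)
  ultimately show ?thesis using two_power_dvd_card_E[of _ 2] by force
qed

lemma ec_eta_iter_eq: "A \<in> E \<Longrightarrow> ec_eta_iter p m i j A = Some ((\<eta> ^^ j) A)"
  by (induction j) (simp_all add: ec_eta_eq iter_in)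

lemma two_torsion: "ec_two_torsion p s - {Infinity} = {z, ec_affine p s 0, ec_affine p (- s) 0}"
  by (auto simp: ec_two_torsion_def z_def)

text \<open>The points \<open>(s, 0)\<close> and \<open>(- s, 0)\<close> are exactly the preimages
  of \<open>z\<close>, so reaching one of them amounts to reaching \<open>z\<close> one step
  later.\<close>

lemma condition_iff:
  assumes "on_curve x y"
  shows "ec_eta_condition p m i s j x y \<longleftrightarrow>
    (\<eta> ^^ j) (ec_affine p x y) = z \<or> (\<eta> ^^ Suc j) (ec_affine p x y) = z"
proof -
  have E: "ec_affine p x y \<in> E" using assms by (simp add: affine_in_E_iff)
  have "(\<eta> ^^ Suc j) (ec_affine p x y) = z \<longleftrightarrow>
      (\<eta> ^^ j) (ec_affine p x y) \<in> {ec_affine p s 0, ec_affine p (- s) 0}"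
    using eta_eq_z_imp[OF iter_in[OF E]] eta_s by auto
  thus ?thesis unfolding ec_eta_condition_def two_torsion ec_eta_iter_eq[OF E] by auto
qed

end

section \<open>The primality criterion\<close>

text \<open>\<open>p\<close> divides the product of \<open>a v - b u\<close> and
  \<open>a v + b u\<close>, hence one of them. The two-squares identity bounds that factor by
  \<open>p\<close> in absolute value. If it vanishes, the two pairs are proportional; otherwise
  \<open>a u + b v = 0\<close> up to the sign of \<open>b\<close>, so the even \<open>v\<close>
  divides the odd \<open>a\<close>.\<close>

lemma sum_two_squares_unique:
  fixes a b u v p :: int
  assumes p: "prime p" and ab: "a\<^sup>2 + b\<^sup>2 = p" and uv: "u\<^sup>2 + v\<^sup>2 = p"
    and cop: "coprime u v" and par: "odd a" "even v"
  shows "a = u \<or> a = - u"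
proof -
  have core: ?thesis if dvd: "p dvd a * v - b * u" and ab: "a\<^sup>2 + b\<^sup>2 = p" for b
  proof -
    obtain e where e: "a * v - b * u = p * e" using dvd by (auto simp: dvd_def)
    have "(a * u + b * v)\<^sup>2 + (a * v - b * u)\<^sup>2 = (a\<^sup>2 + b\<^sup>2) * (u\<^sup>2 + v\<^sup>2)"
      by (simp add: poly_simps)
    hence total: "(a * u + b * v)\<^sup>2 + (p * e)\<^sup>2 = p\<^sup>2" using e ab uv by (simp add: power2_eq_square)
    hence "(p * e)\<^sup>2 \<le> p\<^sup>2" using zero_le_power2[of "a * u + b * v"] by linarith
    hence "p\<^sup>2 * e\<^sup>2 \<le> p\<^sup>2 * 1" by (simp add: power_mult_distrib)
    moreover have "p\<^sup>2 > 0" using p prime_gt_0_int by simp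
    ultimately have "e\<^sup>2 \<le> 1" by (simp only: mult_le_cancel_left_pos)
    hence "e = 0 \<or> e\<^sup>2 = 1" using zero_less_power2[of e] by (cases "e = 0") linarith+
    thus ?thesis
    proof
      assume "e = 0"
      hence eq: "a * v = b * u" using e by simp
      hence "u dvd a" using cop by (metis coprime_dvd_mult_left_iff dvd_triv_right)
      then obtain f where f: "a = u * f" by (auto simp: dvd_def)
      have u0: "u \<noteq> 0" using f par by auto
      hence "b = v * f" using eq f by (simp add: mult.assoc mult.commute)
      hence "p = p * f\<^sup>2" using ab uv f by (simp add: power_mult_distrib flip: distrib_right)
      hence "f\<^sup>2 = 1" using \<open>p\<^sup>2 > 0\<close> by simp
      thus ?thesis using f by (auto simp: power2_eq_1_iff)
    next
      assume "e\<^sup>2 = 1"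
      hence "a * u + b * v = 0" using total by (simp add: power_mult_distrib)
      hence "a * u = v * (- b)" by (simp add: eq_neg_iff_add_eq_0 mult.commute)
      hence "v dvd a" using cop by (metis coprime_commute coprime_dvd_mult_left_iff dvd_triv_left)
      thus ?thesis using par by (meson dvd_trans)
    qed
  qed
  have "(a * v - b * u) * (a * v - (- b) * u) = a\<^sup>2 * (u\<^sup>2 + v\<^sup>2) - (a\<^sup>2 + b\<^sup>2) * u\<^sup>2"
    by (simp add: poly_simps)
  hence "p dvd (a * v - b * u) * (a * v - (- b) * u)" using ab uv by simp
  hence "p dvd a * v - b * u \<or> p dvd a * v - (- b) * u" using p by (simp only: prime_dvd_mult_iff)
  thus ?thesis using core[of b] core[of "- b"] ab by auto
qed

section \<open>The order of the curve and the condition modulo a prime\<close>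

context eta_curve
begin

lemma card_E_eq:
  assumes k: "k \<ge> 2" and p: "p = 2 ^ (2 * k + 1) + 2 ^ (k + 1) + 1"
    and g: "\<not> QuadRes p g" and t: "[t ^ 4 = m] (mod p)"
  shows "card E = 2 ^ (2 * k + 1)"
proof -
  have "QuadRes p 0" unfolding QuadRes_def by (rule exI[of _ 0]) simp
  hence "\<chi> g = - 1" using g QuadRes_cong[of g 0] by (auto simp: Legendre_def)
  then interpret nr: odd_prime_nonresidue p g by unfold_locales
  have "[i\<^sup>2 = - 1] (mod p)" using i_square by (simp add: cong_iff_dvd_diff)
  hence "QuadRes p (- 1)" "\<not> [- 1 = 0] (mod p)"
    using p_gt_1 by (auto simp: QuadRes_def cong_0_iff)
  hence "\<chi> (- 1) = 1" by (simp add: Legendre_def)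
  define A B where "A = nr.\<phi> m" and "B = nr.\<phi> (g * m)"
  have AB: "A\<^sup>2 + B\<^sup>2 = 4 * p"
    unfolding A_def B_def by (rule nr.phi_square_sum) (fact \<open>\<chi> (- 1) = 1\<close>, fact m_unit)
  have cA: "int (card E) = p + 1 + A" using card_E by (simp add: A_def nr.\<phi>_def)
  have p8: "8 dvd p - 1"
  proof -
    have "(8 :: int) dvd 2 ^ (2 * k + 1)" "(8 :: int) dvd 2 ^ (k + 1)"
      using k le_imp_power_dvd[of 3 "2 * k + 1" "2::int"] le_imp_power_dvd[of 3 "k + 1" "2::int"]
      by simp_all
    thus ?thesis unfolding p by simp
  qed
  have "8 dvd int (card E)" using eight_dvd_card_E[OF t] by presburger
  then obtain j where j: "p + 1 + A = 8 * j" unfolding cA by (auto simp: dvd_def)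
  obtain h where h: "p - 1 = 8 * h" using p8 by (auto simp: dvd_def)
  \<comment> \<open>\<open>a\<close> is odd, so it is \<open>2 ^ k + 1\<close> up to sign. As
    \<open>a\<close> is \<open>- 1\<close> and \<open>2 ^ k + 1\<close> is \<open>1\<close> modulo
    4, the sign is negative.\<close>
  define a where "a = 4 * (j - h) - 1"
  have a: "A = 2 * a" using j h by (simp add: a_def)
  have "even (B\<^sup>2)" using AB a by (metis dvd_add_right_iff dvd_mult2 even_mult_iff even_numeral power2_eq_square)
  then obtain b where b: "B = 2 * b" by auto
  have ab: "a\<^sup>2 + b\<^sup>2 = p" using AB unfolding a b by (simp add: power_mult_distrib)
  have uv: "(2 ^ k + 1)\<^sup>2 + (2 ^ k)\<^sup>2 = p"
    unfolding p power_add power_even_eq power2_sum by simp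
  have "coprime (2 ^ k + 1 :: int) (2 ^ k)" by auto
  hence a': "a = 2 ^ k + 1 \<or> a = - (2 ^ k + 1)"
    using sum_two_squares_unique[OF prime_p ab uv] k by (simp add: a_def)
  have "(4 :: int) dvd 2 ^ k" using k le_imp_power_dvd[of 2 k "2::int"] by simp
  then obtain w where w: "2 ^ k = 4 * (w :: int)" by (auto simp: dvd_def)
  have "a \<noteq> 2 ^ k + 1" unfolding w a_def by presburger
  hence "int (card E) = 2 ^ (2 * k + 1)" using a' cA a p by simp
  thus ?thesis by (metis of_nat_eq_iff of_nat_numeral of_nat_power)
qed

lemma condition_of_prime:
  assumes k: "k \<ge> 2" and p: "p = 2 ^ (2 * k + 1) + 2 ^ (k + 1) + 1"
    and t: "[t ^ 4 = m] (mod p)" and P: "on_curve x y" "\<not> QuadRes p x"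
  shows "ec_eta_condition p m i s (2 * k - 1) x y"
proof -
  have "(\<eta> ^^ (2 * k)) (ec_affine p x y) = z"
  proof (rule iter_eq_z)
    show "card E = 2 ^ Suc (2 * k)" using card_E_eq[OF k p P(2) t] by simp
    show "ec_affine p x y \<in> E" using P(1) by (simp add: affine_in_E_iff)
    show "ec_affine p x y \<notin> \<eta> ` E" using P(2) eta_QuadRes by (metis imageE)
  qed (rule nilpotent_of_neg_fixed)
  \<comment> \<open>\<open>2 * k\<close> is \<open>Suc (2 * k - 1)\<close>, so this is the second
    alternative of \<open>condition_iff\<close>.\<close>
  thus ?thesis using condition_iff[OF P(1), of "2 * k - 1"] k by simp
qed

lemma condition_imp_le:
  assumes P: "on_curve x y" and cond: "ec_eta_condition p m i s (2 * k - 1) x y" and k: "k \<ge> 1"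
  shows "2 ^ (2 * k) \<le> 2 * p + 1"
proof -
  have P': "ec_affine p x y \<in> E" using P by (simp add: affine_in_E_iff)
  \<comment> \<open>\<open>j\<close> is \<open>2 * k - 1\<close> or \<open>2 * k\<close>; the
    exponent \<open>Suc j\<close> in \<open>two_power_dvd_card_E\<close> makes the smaller value
    sufficient.\<close>
  obtain j where j: "2 * k \<le> Suc j" "(\<eta> ^^ j) (ec_affine p x y) = z"
    using cond condition_iff[OF P, of "2 * k - 1"] k by force
  have "(2 :: nat) ^ (2 * k) dvd 2 ^ Suc j" using j(1) by (rule le_imp_power_dvd)
  also have "\<dots> dvd card E" by (rule two_power_dvd_card_E[OF P' j(2)])
  finally have "(2 :: nat) ^ (2 * k) \<le> card E"
    using Infinity_in_E finite_E by (intro dvd_imp_le) (auto simp: card_gt_0_iff)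
  hence "(2 :: int) ^ (2 * k) \<le> int (card E)" by (metis of_nat_le_iff of_nat_numeral of_nat_power)
  thus ?thesis using card_E_le by linarith
qed

end

section \<open>From computations modulo \<open>N\<close> to its prime divisors\<close>

lemma ec_eta_eq_affineD:
  fixes n m i c u v :: int
  assumes n: "odd n" "n > 1" "n dvd i\<^sup>2 + 1" "n dvd c * (1 + i) - 1"
    and eta: "ec_eta n m i (ec_affine n u v) = Some Q" "Q \<noteq> Infinity"
  obtains q where "coprime u n" "n dvd q * u - c * v" "Q = ec_affine n (q\<^sup>2) (- q * (q\<^sup>2 + i * u))"
proof -
  have u: "coprime u n" using ec_eta_affine_cases(2)[OF n, of u m v] eta by (cases "coprime u n") auto
  define q where "q = c * v * modular_inverse n u"
  have "n dvd u * modular_inverse n u - 1"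
    using cong_modular_inverse1[OF u] by (simp add: cong_iff_dvd_diff)
  moreover have "q * u - c * v = c * v * (u * modular_inverse n u - 1)"
    by (simp add: q_def poly_simps)
  ultimately have q: "n dvd q * u - c * v" by simp
  show ?thesis using that[OF u q] ec_eta_affine_cases(1)[OF n u q] eta(1) by simp
qed

text \<open>Once \<open>Infinity\<close> is reached it persists, so an affine result means that
  every step had \<open>x\<close> coprime to \<open>N\<close>. The slope \<open>q\<close> found
  modulo \<open>N\<close> then also serves modulo \<open>p\<close>.\<close>

lemma ec_eta_iter_mod_divisor:
  fixes N p m i c x y :: int
  assumes N: "odd N" "N > 1" "N dvd i\<^sup>2 + 1" "N dvd c * (1 + i) - 1" and p: "p dvd N" "p > 1"
    and "ec_eta_iter N m i j (ec_affine N x y) = Some Q" "Q \<noteq> Infinity"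
  shows "\<exists>a b. Q = ec_affine N a b \<and> ec_eta_iter p m i j (ec_affine p x y) = Some (ec_affine p a b)"
  using assms(7,8)
proof (induction j arbitrary: Q)
  case 0
  thus ?case by auto
next
  case (Suc j)
  then obtain Q' where Q': "ec_eta_iter N m i j (ec_affine N x y) = Some Q'" "ec_eta N m i Q' = Some Q"
    by (auto simp: bind_eq_Some_conv)
  have "Q' \<noteq> Infinity" using Q'(2) Suc.prems(2) by (auto simp: ec_eta_def)
  then obtain u v where uv: "Q' = ec_affine N u v"
    "ec_eta_iter p m i j (ec_affine p x y) = Some (ec_affine p u v)"
    using Suc.IH[OF Q'(1)] by blast
  obtain q where q: "coprime u N" "N dvd q * u - c * v"
    "Q = ec_affine N (q\<^sup>2) (- q * (q\<^sup>2 + i * u))"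
    using ec_eta_eq_affineD[OF N] Q'(2) Suc.prems(2) uv(1) by blast
  have "coprime u p" using q(1) p(1) by (metis coprime_divisors dvd_refl)
  moreover have "odd p" using N(1) p(1) by (meson dvd_trans)
  ultimately have "ec_eta p m i (ec_affine p u v) = Some (ec_affine p (q\<^sup>2) (- q * (q\<^sup>2 + i * u)))"
    using ec_eta_affine_cases(1)[of p i c u q v m] N q(2) p by (meson dvd_trans)
  thus ?case using q(3) uv(2) by auto
qed

lemma ec_eta_condition_mod_divisor:
  fixes N p m i c s x y :: int
  assumes N: "odd N" "N > 1" "N dvd i\<^sup>2 + 1" "N dvd c * (1 + i) - 1" and p: "p dvd N" "p > 1"
    and cond: "ec_eta_condition N m i s j x y"
  shows "ec_eta_condition p m i s j x y"
proof -
  obtain Q where Q: "Q \<in> ec_two_torsion N s - {Infinity}"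
    "ec_eta_iter N m i j (ec_affine N x y) = Some Q"
    using cond by (auto simp: ec_eta_condition_def)
  then obtain a b where ab: "Q = ec_affine N a b"
    "ec_eta_iter p m i j (ec_affine p x y) = Some (ec_affine p a b)"
    using ec_eta_iter_mod_divisor[OF N p Q(2)] by blast
  have reduce: "ec_affine p a b = ec_affine p a' b'"
    if "ec_affine N a b = ec_affine N a' b'" for a' b'
    using that cong_dvd_modulus[OF _ p(1)] by (simp add: ec_affine_eq_iff)
  have "ec_affine N a b \<in> {ec_affine N 0 0, ec_affine N s 0, ec_affine N (- s) 0}"
    using Q(1) unfolding ab(1) ec_two_torsion_def by blast
  hence "ec_affine p a b \<in> ec_two_torsion p s - {Infinity}"
    unfolding ec_two_torsion_def using reduce ec_affine_neq_Infinity by blast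
  thus ?thesis using ab(2) by (auto simp: ec_eta_condition_def)
qed

text \<open>If a prime divisor exceeds its cofactor \<open>e\<close>, a prime divisor of
  \<open>e\<close> is small enough.\<close>

lemma prime_factor_le_sqrt:
  fixes N :: int
  assumes "N > 1" "\<not> prime N"
  obtains p where "prime p" "p dvd N" "p\<^sup>2 \<le> N"
proof -
  obtain p where p: "prime p" "p dvd N" using prime_factor_int[of N] assms(1) by auto
  then obtain e where e: "N = p * e" by (auto simp: dvd_def)
  have p1: "p > 1" using p(1) by (rule prime_gt_1_int)
  have e1: "e > 1"
  proof -
    have "e > 0" using e assms(1) p1 zero_less_mult_pos[of p e] by simp
    moreover have "e \<noteq> 1" using e p(1) assms(2) by auto
    ultimately show ?thesis by simp
  qed
  show ?thesis
  proof (cases "p \<le> e")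
    case True
    thus ?thesis using that[OF p] p1 e by (simp add: power2_eq_square)
  next
    case False
    obtain r where r: "prime r" "r dvd e" using prime_factor_int[of e] e1 by auto
    have "r \<le> e" using r(2) e1 by (intro zdvd_imp_le) auto
    hence "r * r \<le> p * e" using False prime_gt_1_int[OF r(1)] by (intro mult_mono) auto
    thus ?thesis using that[of r] r e by (simp add: power2_eq_square)
  qed
qed

text \<open>Both readings of the condition for composite \<open>N\<close> are covered: computing
  modulo \<open>N\<close> itself and modulo each prime divisor. The proof is a cycle: primality
  gives the first, the first gives the second by reduction, and the second gives primality.\<close>

theorem theorem3p3:
  fixes k :: nat and N m i s x y :: int
  assumes "k \<ge> 2"
    and "N = 2 ^ (2 * k + 1) + 2 ^ (k + 1) + 1"
    and "coprime m N"
    and "\<exists>t. [t ^ 4 = m] (mod N)"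
    and "[i\<^sup>2 = - 1] (mod N)"
    and "[s\<^sup>2 = m] (mod N)"
    and "[y\<^sup>2 = x ^ 3 - m * x] (mod N)"
    and "\<not> QuadRes N x"
  shows "(prime N \<longleftrightarrow> ec_eta_condition N m i s (2 * k - 1) x y) \<and>
         (prime N \<longleftrightarrow>
            (\<forall>p. prime p \<and> p dvd N \<longrightarrow> ec_eta_condition p m i s (2 * k - 1) x y))"
proof -
  have odd_N: "odd N" and N_gt_1: "N > 1" using assms(2) by (simp_all add: add_pos_pos)
  \<comment> \<open>\<open>(N + 1) div 2\<close> is the inverse of 2 modulo \<open>N\<close>, and
    \<open>(1 - i) (1 + i) = 2\<close>.\<close>
  define c where "c = (1 - i) * ((N + 1) div 2)"
  have i: "N dvd i\<^sup>2 + 1" using assms(5) by (simp add: cong_iff_dvd_diff)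
  have c: "N dvd c * (1 + i) - 1"
  proof -
    have "2 * ((N + 1) div 2) = N + 1" using odd_N by (intro dvd_mult_div_cancel) simp
    hence "c * (1 + i) - 1 = N - ((N + 1) div 2) * (i\<^sup>2 + 1)"
      unfolding c_def by (simp add: power2_eq_square algebra_simps)
    thus ?thesis using i by simp
  qed
  have curve: "eta_curve p m i s c" "eta_curve.on_curve p m x y" if "prime p" "p dvd N" for p
  proof -
    have up: "p dvd a" if "N dvd a" for a using that \<open>p dvd N\<close> dvd_trans by blast
    show *: "eta_curve p m i s c"
    proof
      show "odd p" using that(2) odd_N by (meson dvd_trans)
      show "p dvd i\<^sup>2 + 1" "p dvd c * (1 + i) - 1" "p dvd s\<^sup>2 - m"
        using i c assms(6) by (auto intro: up simp: cong_iff_dvd_diff)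
      show "\<not> p dvd m"
        using assms(3) that by (meson coprime_common_divisor not_prime_unit)
    qed fact
    show "eta_curve.on_curve p m x y"
      unfolding eta_curve.on_curve_def[OF *] using assms(7) by (auto intro: up simp: cong_iff_dvd_diff)
  qed
  obtain t where t: "[t ^ 4 = m] (mod N)" using assms(4) by blast
  have "ec_eta_condition N m i s (2 * k - 1) x y" if "prime N"
    by (rule eta_curve.condition_of_prime[OF curve(1) assms(1,2) t curve(2) assms(8)])
       (use that in simp_all)
  moreover have "ec_eta_condition N m i s (2 * k - 1) x y \<Longrightarrow>
      \<forall>p. prime p \<and> p dvd N \<longrightarrow> ec_eta_condition p m i s (2 * k - 1) x y"
    using ec_eta_condition_mod_divisor[OF odd_N N_gt_1 i c] prime_gt_1_int by blast
  moreover have "prime N"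
    if cond: "\<forall>p. prime p \<and> p dvd N \<longrightarrow> ec_eta_condition p m i s (2 * k - 1) x y"
  proof (rule ccontr)
    assume "\<not> prime N"
    then obtain p where p: "prime p" "p dvd N" "p\<^sup>2 \<le> N"
      using prime_factor_le_sqrt N_gt_1 by blast
    have le: "2 ^ (2 * k) \<le> 2 * p + 1"
      using eta_curve.condition_imp_le[OF curve(1)[OF p(1,2)] curve(2)[OF p(1,2)]] cond p(1,2) assms(1)
      by simp
    \<comment> \<open>With \<open>w = 2 ^ (k - 2)\<close> the bound becomes
      \<open>16 w^2 \<le> 2 p + 1\<close>, so \<open>8 w^2 \<le> p\<close> for integers, and
      \<open>64 w^4\<close> already exceeds \<open>N = 32 w^2 + 8 w + 1\<close>.\<close>
    obtain l where l: "k = l + 2" using assms(1) by (metis add.commute le_Suc_ex)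
    define w :: int where "w = 2 ^ l"
    have w: "w \<ge> 1" by (simp add: w_def)
    have "(2 :: int) ^ (2 * k) = 16 * w\<^sup>2"
      unfolding l w_def by (simp add: power_add power_mult_distrib mult.commute flip: power_mult)
    hence "8 * w\<^sup>2 \<le> p" using le by linarith
    hence "(8 * w\<^sup>2)\<^sup>2 \<le> p\<^sup>2" by (intro power_mono) auto
    also have "\<dots> \<le> N" by (rule p(3))
    also have "N = 32 * w\<^sup>2 + 8 * w + 1"
      unfolding assms(2) l w_def by (simp add: power_add power_mult_distrib mult.commute flip: power_mult)
    finally have "64 * (w\<^sup>2 * w\<^sup>2) \<le> 32 * w\<^sup>2 + 8 * w + 1"
      by (simp add: power2_eq_square)
    moreover have "w \<le> w\<^sup>2" "1 \<le> w\<^sup>2" using w by (simp_all add: self_le_power)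
    moreover have "w\<^sup>2 * 1 \<le> w\<^sup>2 * w\<^sup>2" using \<open>1 \<le> w\<^sup>2\<close> by (intro mult_left_mono) auto
    ultimately show False by linarith
  qed
  ultimately show ?thesis by blast
qed

end
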